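(* Let $\omega$ be a weight function with constants $K,b$, let $E\subset\mathbb{R}^{2N}$ be a Lebesgue measurable set, $1\le p\le\infty$ and $\varepsilon\in(0,1)$. Suppose that one of the following conditions holds. (a) There exist $f,g\in\mathcal{S}_\omega(\mathbb{R}^N)$, $f,g\neq0$, and $\lambda\ge0$ such that $$\int_E e^{\lambda\omega(x,\xi)}|Sp_gf(x,\xi)|\,dx\,d\xi\ge(1-\varepsilon)D_\lambda^{(1)}\|e^{2K^2\lambda\omega}Rf\|_p\,\|e^{2K^2\lambda\omega}Rg\|_{p'},$$ where $D_\lambda^{(1)}=(2\pi)^{-N}e^{K(1+2K)\lambda}$. (b) There exist $f,g\in\mathcal{S}_\omega(\mathbb{R}^N)$, $f,g\neq0$, $\lambda\ge0$ and $\mu>\frac{2N}{b(2p)'}$ such that $$\int_E e^{\lambda\omega(x,\xi)}|Rf(x,\xi)|\,dx\,d\xi\ge(1-\varepsilon)D_{\lambda,\mu}^{(2)}\|e^{2(K^2\lambda+\mu)\omega}Sp_gf\|_p,$$ where $$D_{\lambda,\mu}^{(2)}=\frac{e^{K(1+2K)\lambda}\,\|e^{K^2\lambda\omega}g\|_\infty\,\|e^{K^2\lambda\omega}\hat g\|_\infty\,\|e^{-\mu\omega}\|^2_{L^{(2p)'}(\mathbb{R}^{2N})}}{(2\pi)^{2N}\|g\|_2^4}.$$ Then $m(E)\ge1-\varepsilon$, where $m(E)$ is the Lebesgue measure of $E$.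
   Context: A weight function is a continuous increasing (i.e. nondecreasing) function $\omega:[0,\infty)\to[0,\infty)$ such that: ($\alpha$) there is $K\ge1$ with $\omega(2t)\le K(1+\omega(t))$ for all $t\ge0$; ($\beta$) $\omega(t)=o(t)$ as $t\to\infty$; ($\gamma$) there are $a\in\mathbb{R}$, $b>0$ with $\omega(t)\ge a+b\log(1+t)$ for all $t\ge0$; ($\delta$) $t\mapsto\omega(e^t)$ is convex. $K$ and $b$ always denote the constants in ($\alpha$) and ($\gamma$). One extends $\omega$ to $\mathbb{R}^M$ by $\omega(z)=\omega(|z|)$; in particular $\omega(x,\xi)=\omega(|(x,\xi)|)$ on $\mathbb{R}^{2N}$. Fourier transform: $\hat f(\xi)=\int_{\mathbb{R}^N}e^{-ix\xi}f(x)\,dx$. $\mathcal{S}_\omega(\mathbb{R}^N)$ is the set of all $f\in L^1(\mathbb{R}^N)$ with $f,\hat f\in C^\infty(\mathbb{R}^N)$ and $\|e^{\lambda\omega}\partial^\alpha f\|_\infty<\infty$, $\|e^{\lambda\omega}\partial^\alpha\hat f\|_\infty<\infty$ for all $\lambda>0$, $\alpha\in\mathbb{N}_0^N$. Short-time Fourier transform: $V_gf(x,\xi)=\int_{\mathbb{R}^N}f(y)\overline{g(y-x)}e^{-iy\xi}\,dy$. Spectrogram: $Sp_gf(x,\xi)=|V_gf(x,\xi)|^2$. Rihaczek form: $Rf(x,\xi)=e^{-ix\xi}f(x)\overline{\hat f(\xi)}$, $(x,\xi)\in\mathbb{R}^{2N}$. $p'$ is the conjugate exponent of $p\in[1,\infty]$;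 $(2p)'$ is defined by $\frac1{2p}+\frac1{(2p)'}=1$, with $(2p)'=1$ for $p=\infty$. Norms of functions on $\mathbb{R}^N$ are in $L^q(\mathbb{R}^N)$, norms of functions on $\mathbb{R}^{2N}$ are in $L^q(\mathbb{R}^{2N})$. *)

theory Defs
  imports "HOL-Probability.Essential_Supremum" "HOL-Library.Landau_Symbols"
begin

text \<open>The weight function lives on \<open>[0,\<infinity>)\<close>; its values at negative arguments are irrelevant.
  \<open>K\<close> and \<open>b\<close> are the constants of the doubling condition and of the logarithmic lower bound,
  on which the estimates depend quantitatively.\<close>

definition weight_function :: "(real \<Rightarrow> real) \<Rightarrow> real \<Rightarrow> real \<Rightarrow> bool" where
  "weight_function \<omega> K b \<longleftrightarrow>
     continuous_on {0..} \<omega> \<and> mono_on {0..} \<omega> \<and> (\<forall>t\<ge>0. \<omega> t \<ge> 0) \<and>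
     (K \<ge> 1 \<and> (\<forall>t\<ge>0. \<omega> (2 * t) \<le> K * (1 + \<omega> t))) \<and>
     \<omega> \<in> o[at_top](\<lambda>t. t) \<and>
     (b > 0 \<and> (\<exists>a. \<forall>t\<ge>0. \<omega> t \<ge> a + b * ln (1 + t))) \<and>
     convex_on UNIV (\<lambda>t. \<omega> (exp t))"

text \<open>\<open>exp_weighted \<omega> c F\<close> is \<open>e\<^bsup>c\<omega>\<^esup>F\<close>, with \<open>\<omega>\<close> extended radially. On a product type \<open>norm\<close>
  is the Euclidean norm of the pair.\<close>

definition exp_weighted ::
  "(real \<Rightarrow> real) \<Rightarrow> real \<Rightarrow> ('a::euclidean_space \<Rightarrow> 'b::real_normed_vector) \<Rightarrow> 'a \<Rightarrow> 'b" where
  "exp_weighted \<omega> c F = (\<lambda>z. exp (c * \<omega> (norm z)) *\<^sub>R F z)"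

definition epowr :: "ennreal \<Rightarrow> real \<Rightarrow> ennreal" where
  "epowr a r = (if a = \<infinity> then \<infinity> else ennreal (enn2real a powr r))"

definition Lp_norm ::
  "ennreal \<Rightarrow> ('a::euclidean_space \<Rightarrow> 'b::real_normed_vector) \<Rightarrow> ennreal" where
  "Lp_norm p f =
     (if p = \<infinity> then esssup lebesgue (\<lambda>x. ennreal (norm (f x)))
      else epowr (\<integral>\<^sup>+x. ennreal (norm (f x) powr enn2real p) \<partial>lebesgue) (1 / enn2real p))"

text \<open>In \<^typ>\<open>ennreal\<close> one has \<open>inverse 0 = \<infinity>\<close> and \<open>inverse \<infinity> = 0\<close>, so the endpoints \<open>1\<close> and \<open>\<infinity>\<close>
  need no separate treatment.\<close>

definition conj_exponent :: "ennreal \<Rightarrow> ennreal" where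
  "conj_exponent p = inverse (1 - inverse p)"

lemma conj_exponent_sum:
  assumes "1 \<le> p"
  shows "inverse p + inverse (conj_exponent p) = 1"
proof -
  have "inverse p \<le> 1"
    using assms
    by (cases p) (auto simp: inverse_ennreal ennreal_le_1 field_simps ennreal_1[symmetric]
                       simp del: ennreal_1)
  moreover have "inverse (inverse x) = x" for x :: ennreal
    by (cases x; cases "x = 0")
       (auto simp: inverse_ennreal less_le ennreal_top_neq_zero)
  ultimately show ?thesis
    by (simp add: conj_exponent_def add_diff_inverse_ennreal)
qed

definition partial_deriv :: "'n::finite \<Rightarrow> (real^'n \<Rightarrow> complex) \<Rightarrow> real^'n \<Rightarrow> complex" where
  "partial_deriv i f x = vector_derivative (\<lambda>t. f (x + t *\<^sub>R axis i 1)) (at 0)"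

text \<open>Higher partial derivatives are indexed by lists of coordinates instead of multi-indices:
  \<open>\<partial>\<^sup>\<alpha>\<close> is \<open>partials is\<close> for any list \<open>is\<close> in which every \<open>i\<close> occurs \<open>\<alpha>\<^sub>i\<close> times. For smooth
  functions the order of the list does not matter.\<close>

definition partials :: "'n::finite list \<Rightarrow> (real^'n \<Rightarrow> complex) \<Rightarrow> real^'n \<Rightarrow> complex" where
  "partials is f = foldr partial_deriv is f"

definition smooth :: "(real^'n::finite \<Rightarrow> complex) \<Rightarrow> bool" where
  "smooth f \<longleftrightarrow>
     (\<forall>is. continuous_on UNIV (partials is f) \<and>
           (\<forall>i x. (\<lambda>t. partials is f (x + t *\<^sub>R axis i 1)) differentiable (at (0::real))))"

definition fourier :: "(real^'n::finite \<Rightarrow> complex) \<Rightarrow> real^'n \<Rightarrow> complex" where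
  "fourier f \<xi> = (LINT x|lebesgue. exp (- \<i> * complex_of_real (x \<bullet> \<xi>)) * f x)"

definition S_omega :: "(real \<Rightarrow> real) \<Rightarrow> (real^'n::finite \<Rightarrow> complex) set" where
  "S_omega \<omega> = {f. integrable lebesgue f \<and> smooth f \<and> smooth (fourier f) \<and>
     (\<forall>l>0. \<forall>is. Lp_norm \<infinity> (exp_weighted \<omega> l (partials is f)) < \<infinity> \<and>
                 Lp_norm \<infinity> (exp_weighted \<omega> l (partials is (fourier f))) < \<infinity>)}"

definition stft ::
  "(real^'n::finite \<Rightarrow> complex) \<Rightarrow> (real^'n \<Rightarrow> complex) \<Rightarrow> (real^'n) \<times> (real^'n) \<Rightarrow> complex" where
  "stft g f = (\<lambda>(x, \<xi>). LINT y|lebesgue.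
     f y * cnj (g (y - x)) * exp (- \<i> * complex_of_real (y \<bullet> \<xi>)))"

definition spectrogram ::
  "(real^'n::finite \<Rightarrow> complex) \<Rightarrow> (real^'n \<Rightarrow> complex) \<Rightarrow> (real^'n) \<times> (real^'n) \<Rightarrow> real" where
  "spectrogram g f z = (norm (stft g f z))\<^sup>2"

definition rihaczek ::
  "(real^'n::finite \<Rightarrow> complex) \<Rightarrow> (real^'n) \<times> (real^'n) \<Rightarrow> complex" where
  "rihaczek f = (\<lambda>(x, \<xi>). exp (- \<i> * complex_of_real (x \<bullet> \<xi>)) * f x * cnj (fourier f \<xi>))"

text \<open>The constants \<open>D\<^bsup>(1)\<^esup>\<close> and \<open>D\<^bsup>(2)\<^esup>\<close> of the two estimates; \<open>N\<close> is the space dimension, and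
  \<open>q\<close> will be the conjugate exponent of \<open>2p\<close>.\<close>

definition D1 :: "nat \<Rightarrow> real \<Rightarrow> real \<Rightarrow> ennreal" where
  "D1 N K l = ennreal (exp (K * (1 + 2 * K) * l) / (2 * pi) ^ N)"

definition D2 ::
  "(real \<Rightarrow> real) \<Rightarrow> real \<Rightarrow> ennreal \<Rightarrow> (real^'n::finite \<Rightarrow> complex) \<Rightarrow> real \<Rightarrow> real \<Rightarrow> ennreal" where
  "D2 \<omega> K q g l \<mu> =
     ennreal (exp (K * (1 + 2 * K) * l))
       * Lp_norm \<infinity> (exp_weighted \<omega> (K\<^sup>2 * l) g)
       * Lp_norm \<infinity> (exp_weighted \<omega> (K\<^sup>2 * l) (fourier g))
       * (Lp_norm q (\<lambda>z :: (real^'n) \<times> (real^'n). exp (- \<mu> * \<omega> (norm z))))\<^sup>2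
     / (ennreal ((2 * pi) ^ (2 * CARD('n))) * (Lp_norm 2 g) ^ 4)"

end

theory Submission
  imports Defs "HOL-Probability.Characteristic_Functions" "HOL-Probability.Sinc_Integral"
begin

text \<open>Both parts rest on a pointwise bound \<open>F \<le> C\<close> for the integrand \<open>F\<close>, where \<open>C\<close> is the
  right-hand side of the hypothesis without the factor \<open>1 - \<epsilon>\<close>. Integrating over \<open>E\<close> gives
  \<open>(1 - \<epsilon>) C \<le> C m(E)\<close>, and \<open>C\<close> cancels: it is positive because \<open>F\<close> does not vanish
  identically, and finite because \<open>\<integral>F < \<infinity>\<close>.

  In (a), Parseval's identity in the form \<open>(2\<pi>)\<^sup>N |V\<^sub>gf(x,\<xi>)| = |V\<^bsub>g^\<^esub>f^(\<xi>,-x)|\<close> bounds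
  \<open>(2\<pi>)\<^sup>N Sp\<^sub>gf(z)\<close> by \<open>\<integral>|Rf(w)||Rg(w-z)|dw\<close>; the weight is distributed by
  \<open>\<omega>(z) \<le> K(1 + \<omega>(w) + \<omega>(w-z))\<close>, and Hoelder's inequality concludes.

  In (b), Fourier inversion for \<open>V\<^sub>gf(y,\<cdot>)\<close>, the transform of \<open>t \<mapsto> f(t) cnj(g(t-y))\<close>, gives
  \<open>(2\<pi>)\<^sup>N |f(x)||g(x-y)| \<le> \<integral>|V\<^sub>gf(y,\<eta>)|d\<eta>\<close>. Multiplying by \<open>|g(x-y)|\<close> and integrating
  in \<open>y\<close> bounds \<open>|f(x)|\<close>, the same argument on the Fourier side bounds \<open>|f^(\<xi>)|\<close>, and Hoelder's
  inequality with exponent \<open>2p\<close> concludes.\<close>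

subsection \<open>Gaussians and Fourier inversion\<close>

lemma lborel_integral_affine:
  fixes f :: "'a::euclidean_space \<Rightarrow> complex"
  assumes "c \<noteq> 0" and [measurable]: "f \<in> borel_measurable borel"
  shows "(LINT x|lborel. f x) = \<bar>c\<bar> ^ DIM('a) *\<^sub>R (LINT x|lborel. f (t + c *\<^sub>R x))"
  by (subst lborel_affine[OF \<open>c \<noteq> 0\<close>, of t]) (simp add: integral_density integral_distr)

lemma lborel_integrable_affine:
  fixes f :: "'a::euclidean_space \<Rightarrow> complex"
  assumes "c \<noteq> 0" and f: "integrable lborel f"
  shows "integrable lborel (\<lambda>x. f (t + c *\<^sub>R x))"
proof -
  have [measurable]: "f \<in> borel_measurable borel"
    using f by simp
  have "integrable (density (distr lborel borel (\<lambda>x. t + c *\<^sub>R x)) (\<lambda>_. ennreal (\<bar>c\<bar> ^ DIM('a)))) f"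
    using f lborel_affine[OF \<open>c \<noteq> 0\<close>, of t] by simp
  then have "integrable (distr lborel borel (\<lambda>x. t + c *\<^sub>R x)) (\<lambda>x. (\<bar>c\<bar> ^ DIM('a)) *\<^sub>R f x)"
    by (subst (asm) integrable_density) auto
  then show ?thesis
    using assms(1) integrable_scaleR_right[of "inverse (\<bar>c\<bar> ^ DIM('a))" lborel "\<lambda>x. \<bar>c\<bar> ^ DIM('a) *\<^sub>R f (t + c *\<^sub>R x)"]
    by (simp add: integrable_distr_eq)
qed

lemma nn_integral_lborel_translate:
  fixes f :: "'a::euclidean_space \<Rightarrow> ennreal"
  assumes [measurable]: "f \<in> borel_measurable borel"
  shows "(\<integral>\<^sup>+x. f (x - a) \<partial>lborel) = (\<integral>\<^sup>+x. f x \<partial>lborel)"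
  by (subst (2) lborel_affine[of 1 "- a"]) (simp_all add: nn_integral_density nn_integral_distr)

lemma nn_integral_lborel_reflect:
  fixes f :: "'a::euclidean_space \<Rightarrow> ennreal"
  assumes [measurable]: "f \<in> borel_measurable borel"
  shows "(\<integral>\<^sup>+x. f (a - x) \<partial>lborel) = (\<integral>\<^sup>+x. f x \<partial>lborel)"
  by (subst (2) lborel_affine[of "- 1" a]) (simp_all add: nn_integral_density nn_integral_distr)

text \<open>\<open>lborel\<close> is by construction the image of the product, indexed by
  \<open>Basis\<close>, of one-dimensional Lebesgue measures, so both claims reduce to Fubini's
  theorem for finite products.\<close>

lemma
  fixes f :: "'a::euclidean_space \<Rightarrow> real \<Rightarrow> complex"
  assumes f: "\<And>b. b \<in> Basis \<Longrightarrow> integrable lborel (f b)"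
  shows lborel_integrable_prod: "integrable lborel (\<lambda>x. \<Prod>b\<in>Basis. f b (x \<bullet> b))"
    and lborel_integral_prod: "(LINT x|lborel. (\<Prod>b\<in>Basis. f b (x \<bullet> b))) = (\<Prod>b\<in>Basis. LINT x|lborel. f b x)"
proof -
  interpret product_sigma_finite "\<lambda>_::'a. lborel :: real measure" ..
  have [measurable]: "f b \<in> borel_measurable borel" if "b \<in> Basis" for b
    using f[OF that] by simp
  show "integrable lborel (\<lambda>x. \<Prod>b\<in>Basis. f b (x \<bullet> b))"
    using product_integrable_prod[of Basis f] f
    by (subst lborel_def) (simp add: integrable_distr_eq lborel_eq_real[symmetric])
  show "(LINT x|lborel. (\<Prod>b\<in>Basis. f b (x \<bullet> b))) = (\<Prod>b\<in>Basis. LINT x|lborel. f b x)"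
    using product_integral_prod[of Basis f] f
    by (subst lborel_def) (simp add: integral_distr lborel_eq_real[symmetric])
qed

text \<open>The standard normal density. The product form is chosen so that its Fourier integral
  factors over the coordinates; \<open>gauss_eq\<close> recovers the radial form.\<close>

definition gauss :: "'a::euclidean_space \<Rightarrow> real" where
  "gauss v = (\<Prod>b\<in>Basis. std_normal_density (v \<bullet> b))"

lemma gauss_eq: "gauss v = (1 / sqrt (2 * pi)) ^ DIM('a) * exp (- (norm v)\<^sup>2 / 2)"
  for v :: "'a::euclidean_space"
proof -
  have "(norm v)\<^sup>2 = (\<Sum>b\<in>Basis. (v \<bullet> b)\<^sup>2)"
    unfolding power2_norm_eq_inner by (subst euclidean_inner) (simp add: power2_eq_square)
  then show ?thesis
    by (simp add: gauss_def std_normal_density_def prod.distrib exp_sum[symmetric]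
        sum_negf sum_divide_distrib[symmetric] power_divide prod_dividef)
qed

lemma gauss_nonneg: "gauss v \<ge> 0"
  by (simp add: gauss_eq)

lemma gauss_measurable [measurable]: "gauss \<in> borel_measurable borel"
  unfolding gauss_def by measurable

text \<open>The value is the characteristic function of the standard normal distribution, rewritten
  as a Lebesgue integral against the density.\<close>

lemma std_normal_iexp:
  "integrable lborel (\<lambda>x. iexp (t * x) * complex_of_real (std_normal_density x))"
  "(LINT x|lborel. iexp (t * x) * complex_of_real (std_normal_density x)) = exp (- t\<^sup>2 / 2)"
proof -
  interpret real_distribution std_normal_distribution
    by (rule real_dist_normal_dist)
  have "integrable std_normal_distribution (\<lambda>x. iexp (t * x))"
    by (intro integrable_iexp) auto
  then show "integrable lborel (\<lambda>x. iexp (t * x) * complex_of_real (std_normal_density x))"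
    by (subst (asm) integrable_density) (auto simp: scaleR_conv_of_real mult.commute)
  have "complex_of_real (exp (- t\<^sup>2 / 2)) = char std_normal_distribution t"
    by (simp add: char_std_normal_distribution)
  also have "\<dots> = (LINT x|lborel. iexp (t * x) * complex_of_real (std_normal_density x))"
    unfolding char_def by (subst integral_density) (auto simp: scaleR_conv_of_real mult.commute)
  finally show "(LINT x|lborel. iexp (t * x) * complex_of_real (std_normal_density x)) = exp (- t\<^sup>2 / 2)"
    by simp
qed

text \<open>Character and density are both products over the coordinates, so the one-dimensional
  case suffices. Up to normalisation the Gaussian is its own Fourier transform, which drives
  \<open>gauss_mollify\<close>.\<close>

lemma gauss_iexp:
  fixes u :: "'a::euclidean_space"
  shows "integrable lborel (\<lambda>v. iexp (u \<bullet> v) * complex_of_real (gauss v))"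
    and "(LINT v|lborel. iexp (u \<bullet> v) * complex_of_real (gauss v)) = exp (- (norm u)\<^sup>2 / 2)"
proof -
  have eq: "iexp (u \<bullet> v) * complex_of_real (gauss v) =
    (\<Prod>b\<in>Basis. iexp ((u \<bullet> b) * (v \<bullet> b)) * complex_of_real (std_normal_density (v \<bullet> b)))" for v
    by (simp add: gauss_def prod.distrib exp_sum[symmetric] euclidean_inner[of u v] sum_distrib_left)
  show "integrable lborel (\<lambda>v. iexp (u \<bullet> v) * complex_of_real (gauss v))"
    unfolding eq
    by (rule lborel_integrable_prod[where f="\<lambda>b x. iexp ((u \<bullet> b) * x) * complex_of_real (std_normal_density x)"])
       (rule std_normal_iexp)
  have "(LINT v|lborel. iexp (u \<bullet> v) * complex_of_real (gauss v)) =
      (\<Prod>b\<in>Basis. complex_of_real (exp (- (u \<bullet> b)\<^sup>2 / 2)))"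
    unfolding eq
    by (subst lborel_integral_prod[where f="\<lambda>b x. iexp ((u \<bullet> b) * x) * complex_of_real (std_normal_density x)"])
       (simp_all only: std_normal_iexp)
  also have "\<dots> = exp (- (\<Sum>b\<in>Basis. (u \<bullet> b)\<^sup>2) / 2)"
    by (simp add: exp_sum[symmetric] sum_negf sum_divide_distrib[symmetric] flip: of_real_prod)
  also have "(\<Sum>b\<in>Basis. (u \<bullet> b)\<^sup>2) = (norm u)\<^sup>2"
    unfolding power2_norm_eq_inner by (subst euclidean_inner) (simp add: power2_eq_square)
  finally show "(LINT v|lborel. iexp (u \<bullet> v) * complex_of_real (gauss v)) = exp (- (norm u)\<^sup>2 / 2)" .
qed

lemma integrable_gauss: "integrable lborel (gauss :: 'a::euclidean_space \<Rightarrow> real)"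
proof -
  have "integrable lborel (\<lambda>v::'a. norm (complex_of_real (gauss v)))"
    using gauss_iexp(1)[of "0::'a"] by (intro integrable_norm) simp
  then show ?thesis
    by (simp add: gauss_nonneg)
qed

lemma integral_gauss: "(LINT v|lborel. gauss (v::'a::euclidean_space)) = 1"
  using gauss_iexp(2)[of "0::'a"] by simp

section \<open>The Fourier transform and its inversion\<close>

lemma fourier_lborel:
  assumes [measurable]: "f \<in> borel_measurable borel"
  shows "fourier f \<xi> = (LINT y|lborel. exp (- \<i> * complex_of_real (y \<bullet> \<xi>)) * f y)"
  unfolding fourier_def by (rule integral_completion) measurable

lemma fourier_measurable [measurable]:
  assumes [measurable]: "f \<in> borel_measurable borel"
  shows "fourier f \<in> borel_measurable borel"
  unfolding fourier_lborel[OF assms, abs_def] by measurable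

text \<open>The Gaussian \<open>e\<^bsup>-|\<delta>\<eta>|^2/2\<^esup>\<close> makes the Fubini argument for the inversion formula
  absolutely convergent; the limit \<open>\<delta> \<rightarrow> 0\<close> removes it again.\<close>

lemma gauss_mollify:
  fixes h :: "real^'n::finite \<Rightarrow> complex"
  assumes h: "integrable lborel h" and "\<delta> > 0"
  shows "(LINT \<eta>|lborel. exp (- (norm (\<delta> *\<^sub>R \<eta>))\<^sup>2 / 2) * (iexp (x \<bullet> \<eta>) * fourier h \<eta>))
    = (2 * pi) ^ CARD('n) * (LINT u|lborel. h (x - \<delta> *\<^sub>R u) * gauss u)" (is "?I = _")
proof -
  \<comment> \<open>The normalising constant in \<open>gauss_eq\<close>. Its square is (2 pi)^(-N),
    the source of the factor (2 pi)^N in the inversion formula.\<close>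
  define c where "c = (1 / sqrt (2 * pi)) ^ CARD('n)"
  have "c * c * (2 * pi) ^ CARD('n) = ((1 / sqrt (2 * pi)) * (1 / sqrt (2 * pi)) * (2 * pi)) ^ CARD('n)"
    by (simp only: c_def power_mult_distrib)
  also have "(1 / sqrt (2 * pi)) * (1 / sqrt (2 * pi)) * (2 * pi) = 1"
    by (simp only: times_divide_times_eq real_sqrt_mult_self) simp
  finally have c2: "c * c * (2 * pi) ^ CARD('n) = 1"
    by simp
  have [measurable]: "h \<in> borel_measurable borel"
    using h by simp
  have h': "integrable lborel (\<lambda>u. h (x - \<delta> *\<^sub>R u))"
    using lborel_integrable_affine[OF _ h, of "- \<delta>" x] \<open>\<delta> > 0\<close> by simp
  \<comment> \<open>The substitution y = x - \<delta> u in the integral defining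
    \<open>fourier h\<close> at v / \<delta>; its Jacobian accounts for the power of
    \<delta>.\<close>
  have inner: "(LINT u|lborel. h (x - \<delta> *\<^sub>R u) * iexp (u \<bullet> v)) =
     (1 / \<delta>) ^ CARD('n) *\<^sub>R (iexp (x \<bullet> (v /\<^sub>R \<delta>)) * fourier h (v /\<^sub>R \<delta>))" for v
  proof -
    have "fourier h (v /\<^sub>R \<delta>) = \<delta> ^ CARD('n) *\<^sub>R
       (LINT u|lborel. exp (- \<i> * complex_of_real ((x - \<delta> *\<^sub>R u) \<bullet> (v /\<^sub>R \<delta>))) * h (x - \<delta> *\<^sub>R u))"
      using \<open>\<delta> > 0\<close> by (subst fourier_lborel, simp, subst lborel_integral_affine[of "- \<delta>" _ x]) simp_all
    also have "(\<lambda>u. exp (- \<i> * complex_of_real ((x - \<delta> *\<^sub>R u) \<bullet> (v /\<^sub>R \<delta>))) * h (x - \<delta> *\<^sub>R u)) =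
      (\<lambda>u. iexp (- (x \<bullet> (v /\<^sub>R \<delta>))) * (h (x - \<delta> *\<^sub>R u) * iexp (u \<bullet> v)))"
    proof (rule ext)
      fix u
      have "(x - \<delta> *\<^sub>R u) \<bullet> (v /\<^sub>R \<delta>) = x \<bullet> (v /\<^sub>R \<delta>) - u \<bullet> v"
        using \<open>\<delta> > 0\<close> by (simp add: inner_diff_left right_diff_distrib)
      then have "exp (- \<i> * complex_of_real ((x - \<delta> *\<^sub>R u) \<bullet> (v /\<^sub>R \<delta>))) =
          iexp (- (x \<bullet> (v /\<^sub>R \<delta>))) * iexp (u \<bullet> v)"
        by (simp add: exp_add[symmetric] right_diff_distrib)
      then show "exp (- \<i> * complex_of_real ((x - \<delta> *\<^sub>R u) \<bullet> (v /\<^sub>R \<delta>))) * h (x - \<delta> *\<^sub>R u) =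
          iexp (- (x \<bullet> (v /\<^sub>R \<delta>))) * (h (x - \<delta> *\<^sub>R u) * iexp (u \<bullet> v))"
        by simp
    qed
    finally have *: "fourier h (v /\<^sub>R \<delta>) = \<delta> ^ CARD('n) *\<^sub>R (iexp (- (x \<bullet> (v /\<^sub>R \<delta>))) *
       (LINT u|lborel. h (x - \<delta> *\<^sub>R u) * iexp (u \<bullet> v)))"
      by simp
    have "iexp (x \<bullet> (v /\<^sub>R \<delta>)) * iexp (- (x \<bullet> (v /\<^sub>R \<delta>))) = 1"
      by (simp add: exp_add[symmetric])
    moreover have "(1 / \<delta>) ^ CARD('n) * \<delta> ^ CARD('n) = 1"
      using \<open>\<delta> > 0\<close> by (simp add: power_one_over)
    ultimately show ?thesis
      unfolding * by (simp only: mult_scaleR_right scaleR_scaleR mult.assoc[symmetric]) simp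
  qed
  \<comment> \<open>By \<open>gauss_iexp\<close>, \<open>gauss u\<close> is c times the Fourier
    integral of \<open>gauss\<close>; this introduces the second variable v for Fubini's
    theorem.\<close>
  have "(LINT u|lborel. h (x - \<delta> *\<^sub>R u) * gauss u)
      = (LINT u|lborel. (LINT v|lborel. c * (h (x - \<delta> *\<^sub>R u) * (iexp (u \<bullet> v) * complex_of_real (gauss v)))))"
  proof (intro Bochner_Integration.integral_cong refl)
    fix u :: "real^'n"
    have "(LINT v|lborel. c * (h (x - \<delta> *\<^sub>R u) * (iexp (u \<bullet> v) * complex_of_real (gauss v)))) =
       c * (h (x - \<delta> *\<^sub>R u) * complex_of_real (exp (- (norm u)\<^sup>2 / 2)))"
      by (simp only: integral_mult_right_zero gauss_iexp)
    also have "\<dots> = h (x - \<delta> *\<^sub>R u) * gauss u"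
      by (simp add: gauss_eq c_def)
    finally show "h (x - \<delta> *\<^sub>R u) * gauss u =
       (LINT v|lborel. c * (h (x - \<delta> *\<^sub>R u) * (iexp (u \<bullet> v) * complex_of_real (gauss v))))"
      by (rule sym)
  qed
  also have "\<dots> = (LINT v|lborel. (LINT u|lborel. c * (h (x - \<delta> *\<^sub>R u) * (iexp (u \<bullet> v) * complex_of_real (gauss v)))))"
  proof (rule lborel_pair.Fubini_integral[symmetric])
    show "integrable (lborel \<Otimes>\<^sub>M lborel)
     (\<lambda>(u, v). c * (h (x - \<delta> *\<^sub>R u) * (iexp (u \<bullet> v) * complex_of_real (gauss v))))"
    proof (rule lborel_pair.Fubini_integrable)
      show "AE u in lborel. integrable lborel (\<lambda>v. case (u, v) of (u, v) \<Rightarrow>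
          c * (h (x - \<delta> *\<^sub>R u) * (iexp (u \<bullet> v) * complex_of_real (gauss v))))"
        by (auto intro!: AE_I2 integrable_mult_right gauss_iexp)
      \<comment> \<open>The modulus of the integrand is c |h (x - \<delta> u)|
        \<open>gauss v\<close>, a product of integrable functions of u and of v.\<close>
      have "integrable lborel (\<lambda>u. norm (h (x - \<delta> *\<^sub>R u)) * c * (LINT v|lborel. norm (complex_of_real (gauss (v::real^'n)))))"
        using h' by (intro integrable_mult_left integrable_norm)
      then show "integrable lborel (\<lambda>u. LINT v|lborel. norm (case (u, v) of (u, v) \<Rightarrow>
          c * (h (x - \<delta> *\<^sub>R u) * (iexp (u \<bullet> v) * complex_of_real (gauss v)))))"
        by (simp add: norm_mult c_def norm_power mult_ac)
    qed measurable
  qed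
  also have "\<dots> = (LINT v|lborel. (c * (1 / \<delta>) ^ CARD('n)) *\<^sub>R (gauss v * (iexp (x \<bullet> (v /\<^sub>R \<delta>)) * fourier h (v /\<^sub>R \<delta>))))"
  proof (intro Bochner_Integration.integral_cong refl)
    fix v :: "real^'n"
    have "(LINT u|lborel. c * (h (x - \<delta> *\<^sub>R u) * (iexp (u \<bullet> v) * complex_of_real (gauss v))))
       = (LINT u|lborel. (c * gauss v) * (h (x - \<delta> *\<^sub>R u) * iexp (u \<bullet> v)))"
      by (simp add: mult_ac)
    also have "\<dots> = (c * gauss v) * (LINT u|lborel. h (x - \<delta> *\<^sub>R u) * iexp (u \<bullet> v))"
      by (rule integral_mult_right_zero)
    finally show "(LINT u|lborel. c * (h (x - \<delta> *\<^sub>R u) * (iexp (u \<bullet> v) * complex_of_real (gauss v)))) =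
       (c * (1 / \<delta>) ^ CARD('n)) *\<^sub>R (gauss v * (iexp (x \<bullet> (v /\<^sub>R \<delta>)) * fourier h (v /\<^sub>R \<delta>)))"
      unfolding inner by (simp add: scaleR_conv_of_real mult_ac)
  qed
  also have "\<dots> = (c * (1 / \<delta>) ^ CARD('n)) *\<^sub>R (LINT v|lborel. (gauss v * (iexp (x \<bullet> (v /\<^sub>R \<delta>)) * fourier h (v /\<^sub>R \<delta>))))"
    by simp
  \<comment> \<open>The substitution v = \<delta> \<eta>; its Jacobian cancels the earlier power of
    1 / \<delta>.\<close>
  also have "(LINT v|lborel. (gauss v * (iexp (x \<bullet> (v /\<^sub>R \<delta>)) * fourier h (v /\<^sub>R \<delta>)))) 
     = \<delta> ^ CARD('n) *\<^sub>R (LINT \<eta>|lborel. gauss (\<delta> *\<^sub>R \<eta>) * (iexp (x \<bullet> \<eta>) * fourier h \<eta>))"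
    using \<open>\<delta> > 0\<close> by (subst lborel_integral_affine[of "\<delta>" _ 0]) simp_all
  also have "(LINT \<eta>|lborel. gauss (\<delta> *\<^sub>R \<eta>) * (iexp (x \<bullet> \<eta>) * fourier h \<eta>)) =
     c * (LINT \<eta>|lborel. exp (- (norm (\<delta> *\<^sub>R \<eta>))\<^sup>2 / 2) * (iexp (x \<bullet> \<eta>) * fourier h \<eta>))"
    by (simp add: gauss_eq c_def mult.assoc)
  finally have *: "(LINT u|lborel. h (x - \<delta> *\<^sub>R u) * gauss u) =
     (c * (1 / \<delta>) ^ CARD('n)) *\<^sub>R \<delta> ^ CARD('n) *\<^sub>R (c * ?I)"
    by simp
  have "(2 * pi) ^ CARD('n) * (c * ((1 / \<delta>) ^ CARD('n) * (\<delta> ^ CARD('n) * c))) = 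
      (c * c * (2 * pi) ^ CARD('n)) * ((1 / \<delta>) * \<delta>) ^ CARD('n)"
    by (simp only: power_mult_distrib mult_ac)
  also have "(1 / \<delta>) * \<delta> = 1"
    using \<open>\<delta> > 0\<close> by simp
  finally have "(2 * pi) ^ CARD('n) * (c * ((1 / \<delta>) ^ CARD('n) * (\<delta> ^ CARD('n) * c))) = 1"
    by (simp only: c2 power_one mult_1_left)
  then show ?thesis
    unfolding * by (simp only: scaleR_conv_of_real mult.assoc[symmetric] of_real_mult[symmetric] of_real_1 mult_1_left)
qed

text \<open>Let \<delta> tend to 0 in \<open>gauss_mollify\<close>. On the left the modulus of
  \<open>fourier h\<close> dominates. On the right, averages of h over shrinking Gaussians around x
  tend to h x by continuity, dominated by B times the Gaussian.\<close>

theorem fourier_inversion: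
  fixes h :: "real^'n::finite \<Rightarrow> complex"
  assumes h: "integrable lborel h" and cont: "continuous_on UNIV h" and B: "\<And>x. norm (h x) \<le> B"
    and h': "integrable lborel (fourier h)"
  shows "(LINT \<eta>|lborel. iexp (x \<bullet> \<eta>) * fourier h \<eta>) = (2 * pi) ^ CARD('n) * h x"
proof -
  define \<delta> where "\<delta> n = 1 / real (Suc n)" for n
  have \<delta>0: "\<delta> \<longlonglongrightarrow> 0"
    unfolding \<delta>_def by (rule LIMSEQ_Suc[OF lim_1_over_n])
  have [measurable]: "h \<in> borel_measurable borel"
    using h by simp
  have "(\<lambda>n. LINT \<eta>|lborel. exp (- (norm (\<delta> n *\<^sub>R \<eta>))\<^sup>2 / 2) * (iexp (x \<bullet> \<eta>) * fourier h \<eta>))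
      \<longlonglongrightarrow> (LINT \<eta>|lborel. iexp (x \<bullet> \<eta>) * fourier h \<eta>)"
  proof (rule integral_dominated_convergence[where w="\<lambda>\<eta>. norm (fourier h \<eta>)"])
    show "AE \<eta> in lborel. (\<lambda>n. exp (- (norm (\<delta> n *\<^sub>R \<eta>))\<^sup>2 / 2) * (iexp (x \<bullet> \<eta>) * fourier h \<eta>))
         \<longlonglongrightarrow> iexp (x \<bullet> \<eta>) * fourier h \<eta>"
    proof (rule AE_I2)
      fix \<eta> :: "real^'n"
      have "(\<lambda>n. complex_of_real (exp (- (norm (\<delta> n *\<^sub>R \<eta>))\<^sup>2 / 2)) * (iexp (x \<bullet> \<eta>) * fourier h \<eta>))
         \<longlonglongrightarrow> complex_of_real (exp (- (norm (0 *\<^sub>R \<eta>))\<^sup>2 / 2)) * (iexp (x \<bullet> \<eta>) * fourier h \<eta>)"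
        by (intro tendsto_intros \<delta>0) auto
      then show "(\<lambda>n. exp (- (norm (\<delta> n *\<^sub>R \<eta>))\<^sup>2 / 2) * (iexp (x \<bullet> \<eta>) * fourier h \<eta>))
         \<longlonglongrightarrow> iexp (x \<bullet> \<eta>) * fourier h \<eta>"
        by simp
    qed
  qed (use h' in \<open>auto simp: norm_mult intro!: AE_I2 mult_left_le_one_le\<close>)
  moreover have "(\<lambda>n. (2 * pi) ^ CARD('n) * (LINT u|lborel. h (x - \<delta> n *\<^sub>R u) * gauss u))
      \<longlonglongrightarrow> (2 * pi) ^ CARD('n) * (LINT u|lborel. h x * complex_of_real (gauss (u :: real^'n)))"
  proof (intro tendsto_mult tendsto_const integral_dominated_convergence[where w="\<lambda>u. B * gauss u"])
    show "integrable lborel (\<lambda>u::real^'n. B * gauss u)"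
      by (intro integrable_mult_right integrable_gauss)
    have "isCont h x"
      using cont by (simp add: continuous_on_eq_continuous_at)
    then have "(\<lambda>n. h (x - \<delta> n *\<^sub>R u) * complex_of_real (gauss u)) \<longlonglongrightarrow> h x * complex_of_real (gauss u)" for u
      by (intro tendsto_mult tendsto_const isCont_tendsto_compose[of x h] )
         (auto intro!: tendsto_eq_intros \<delta>0)
    then show "AE u in lborel. (\<lambda>n. h (x - \<delta> n *\<^sub>R u) * complex_of_real (gauss u)) \<longlonglongrightarrow> h x * complex_of_real (gauss u)"
      by (intro AE_I2)
    show "AE u in lborel. norm (h (x - \<delta> n *\<^sub>R u) * complex_of_real (gauss u)) \<le> B * gauss u" for n
      using B by (intro AE_I2) (simp add: norm_mult gauss_nonneg mult_right_mono)
  qed measurable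
  moreover have "(LINT u|lborel. h x * complex_of_real (gauss (u :: real^'n))) = h x"
    by (simp only: integral_mult_right_zero integral_complex_of_real integral_gauss) simp
  moreover have "\<delta> n > 0" for n
    by (simp add: \<delta>_def)
  ultimately show ?thesis
    by (simp only: gauss_mollify[OF h] LIMSEQ_unique)
qed

subsection \<open>Lebesgue norms\<close>

lemma epowr_zero_iff: "epowr x r = 0 \<longleftrightarrow> x = 0"
  by (cases x) (auto simp: epowr_def ennreal_eq_0_iff)

lemma epowr_one: "epowr x 1 = x"
  by (cases x) (auto simp: epowr_def)

lemma Lp_norm_top_AE:
  "AE x in lebesgue. ennreal (norm (f x)) \<le> Lp_norm \<infinity> f"
  using esssup_AE by (auto simp: Lp_norm_def)

lemma Lp_norm_one: "Lp_norm 1 f = (\<integral>\<^sup>+x. ennreal (norm (f x)) \<partial>lebesgue)"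
  by (simp add: Lp_norm_def epowr_one)

text \<open>Separates the two endpoint pairs from the interior range, where both exponents are real
  and Young's inequality is available.\<close>

lemma conj_exponent_cases:
  assumes "1 \<le> p"
  obtains "p = 1" "conj_exponent p = \<infinity>" | "p = \<infinity>" "conj_exponent p = 1"
  | r s where "p = ennreal r" "conj_exponent p = ennreal s" "r > 1" "s > 1" "1 / r + 1 / s = 1"
proof (cases p)
  case top
  then show ?thesis
    using that(2) by (simp add: conj_exponent_def)
next
  case (real r)
  show ?thesis
  proof (cases "r = 1")
    case True
    then show ?thesis
      using that(1) real by (simp add: conj_exponent_def)
  next
    case False
    then have r: "r > 1"
      using assms real by (simp add: ennreal_le_iff2 flip: ennreal_1)
    have "1 - inverse p = ennreal (1 - 1 / r)"
      using r real by (simp add: inverse_ennreal divide_inverse ennreal_minus flip: ennreal_1)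
    then have "conj_exponent p = ennreal (r / (r - 1))"
      using r by (simp add: conj_exponent_def inverse_ennreal field_simps)
    then show ?thesis
      using that(3)[of r "r / (r - 1)"] r real by (simp add: field_simps)
  qed
qed

lemma Hoelder_real:
  fixes u v :: "'a::euclidean_space \<Rightarrow> real"
  assumes [measurable]: "u \<in> borel_measurable lebesgue" "v \<in> borel_measurable lebesgue"
    and nn: "\<And>x. 0 \<le> u x" "\<And>x. 0 \<le> v x"
    and rs: "r > 1" "s > 1" "1 / r + 1 / s = 1"
  shows "(\<integral>\<^sup>+x. ennreal (u x * v x) \<partial>lebesgue) \<le> Lp_norm (ennreal r) u * Lp_norm (ennreal s) v"
proof -
  have norm: "Lp_norm (ennreal t) w = epowr (\<integral>\<^sup>+x. ennreal (w x powr t) \<partial>lebesgue) (1 / t)"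
    if "t > 1" "\<And>x. 0 \<le> w x" for t and w :: "'a \<Rightarrow> real"
    using that by (simp add: Lp_norm_def)
  define U where "U = (\<integral>\<^sup>+x. ennreal (u x powr r) \<partial>lebesgue)"
  define V where "V = (\<integral>\<^sup>+x. ennreal (v x powr s) \<partial>lebesgue)"
  show ?thesis
  \<comment> \<open>If one norm vanishes, the product is zero almost everywhere. Settling this first
    keeps 0 times infinity, which is 0 in \<open>ennreal\<close>, out of the infinite case.\<close>
  proof (cases "U = 0 \<or> V = 0")
    case True
    then have "AE x in lebesgue. u x = 0 \<or> v x = 0"
      unfolding U_def V_def by (subst (asm) (1 2) nn_integral_0_iff_AE) (auto simp: ennreal_eq_0_iff nn)
    then have "(\<integral>\<^sup>+x. ennreal (u x * v x) \<partial>lebesgue) = 0"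
      by (subst nn_integral_0_iff_AE) auto
    then show ?thesis by simp
  next
    case pos: False
    show ?thesis
    proof (cases "U = \<infinity> \<or> V = \<infinity>")
      case True
      then have "Lp_norm (ennreal r) u * Lp_norm (ennreal s) v = \<infinity>"
        using pos epowr_zero_iff[of V "1 / s"] epowr_zero_iff[of U "1 / r"]
        by (auto simp: norm nn rs U_def[symmetric] V_def[symmetric] ennreal_mult_eq_top_iff)
           (auto simp: epowr_def)
      then show ?thesis by simp
    next
      case False
      \<comment> \<open>a and b are the two norms. Young's inequality is applied to the normalised
        functions u / a and v / b.\<close>
      define a where "a = enn2real U powr (1 / r)"
      define b where "b = enn2real V powr (1 / s)"
      have U': "enn2real U > 0" "ennreal (enn2real U) = U" and V': "enn2real V > 0" "ennreal (enn2real V) = V"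
        using False pos by (auto simp: enn2real_positive_iff less_top zero_less_iff_neq_zero)
      have ab: "a > 0" "b > 0" "a powr r = enn2real U" "b powr s = enn2real V"
        using U' V' rs by (auto simp: a_def b_def powr_powr)
      have "(\<integral>\<^sup>+x. ennreal (u x * v x) \<partial>lebesgue) \<le>
        (\<integral>\<^sup>+x. ennreal (a * b / (r * enn2real U)) * ennreal (u x powr r) + ennreal (a * b / (s * enn2real V)) * ennreal (v x powr s) \<partial>lebesgue)"
      proof (intro nn_integral_mono)
        fix x
        have "u x / a * (v x / b) \<le> (u x / a) powr r / r + (v x / b) powr s / s"
          using nn ab rs by (intro Youngs_inequality) auto
        then have "u x * v x \<le> a * b * ((u x / a) powr r / r + (v x / b) powr s / s)"
          using ab by (simp add: field_simps)
        also have "\<dots> = a * b / (r * enn2real U) * (u x powr r) + a * b / (s * enn2real V) * (v x powr s)"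
          using ab nn by (simp add: powr_divide algebra_simps)
        finally show "ennreal (u x * v x) \<le> ennreal (a * b / (r * enn2real U)) * ennreal (u x powr r) + ennreal (a * b / (s * enn2real V)) * ennreal (v x powr s)"
          using ab rs U' V' by (simp add: ennreal_mult'[symmetric] ennreal_plus[symmetric] ennreal_leI del: ennreal_plus)
      qed
      also have "\<dots> = ennreal (a * b / (r * enn2real U)) * U + ennreal (a * b / (s * enn2real V)) * V"
        by (simp add: nn_integral_add nn_integral_cmult U_def V_def)
      also have "\<dots> = ennreal (a * b / (r * enn2real U) * enn2real U + a * b / (s * enn2real V) * enn2real V)"
      proof -
        have "ennreal (x * enn2real U) = ennreal x * U" "ennreal (x * enn2real V) = ennreal x * V" for x
          using ennreal_mult''[of "enn2real U" x] ennreal_mult''[of "enn2real V" x] U' V' by simp_all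
        moreover have "0 \<le> a * b / (r * enn2real U) * enn2real U" "0 \<le> a * b / (s * enn2real V) * enn2real V"
          using ab rs by simp_all
        ultimately show ?thesis
          by (simp only: ennreal_plus)
      qed
      \<comment> \<open>After integration the two terms are ab / r and ab / s, and conjugacy sums
        them to ab.\<close>
      also have "a * b / (r * enn2real U) * enn2real U + a * b / (s * enn2real V) * enn2real V = a * b * (1 / r + 1 / s)"
        using U' V' by (simp add: field_simps)
      also have "ennreal \<dots> = Lp_norm (ennreal r) u * Lp_norm (ennreal s) v"
        using False ab by (simp add: rs norm nn U_def[symmetric] V_def[symmetric] epowr_def ennreal_mult a_def b_def)
      finally show ?thesis .
    qed
  qed
qed

lemma Hoelder_one_top:
  fixes u v :: "'a::euclidean_space \<Rightarrow> real"
  assumes [measurable]: "u \<in> borel_measurable lebesgue" "v \<in> borel_measurable lebesgue"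
    and nn: "\<And>x. 0 \<le> u x" "\<And>x. 0 \<le> v x"
  shows "(\<integral>\<^sup>+x. ennreal (u x * v x) \<partial>lebesgue) \<le> Lp_norm 1 u * Lp_norm \<infinity> v"
proof -
  have "(\<integral>\<^sup>+x. ennreal (u x * v x) \<partial>lebesgue) \<le> (\<integral>\<^sup>+x. ennreal (u x) * Lp_norm \<infinity> v \<partial>lebesgue)"
    using Lp_norm_top_AE[of v] by (intro nn_integral_mono_AE) (auto simp: nn ennreal_mult intro!: mult_left_mono)
  also have "\<dots> = Lp_norm 1 u * Lp_norm \<infinity> v"
    using nn by (simp add: nn_integral_multc Lp_norm_one)
  finally show ?thesis .
qed

lemma Lp_norm_Hoelder:
  fixes u v :: "'a::euclidean_space \<Rightarrow> real"
  assumes "1 \<le> p" and uv: "u \<in> borel_measurable lebesgue" "v \<in> borel_measurable lebesgue"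
    and nn: "\<And>x. 0 \<le> u x" "\<And>x. 0 \<le> v x"
  shows "(\<integral>\<^sup>+x. ennreal (u x * v x) \<partial>lebesgue) \<le> Lp_norm p u * Lp_norm (conj_exponent p) v"
  using \<open>1 \<le> p\<close>
proof (cases rule: conj_exponent_cases)
  case 1
  then show ?thesis using Hoelder_one_top[OF uv nn] by simp
next
  case 2
  then show ?thesis using Hoelder_one_top[OF uv(2,1) nn(2,1)] by (simp add: mult.commute)
next
  case (3 r s)
  then show ?thesis using Hoelder_real[OF uv nn] by simp
qed

lemma Lp_norm_norm: "Lp_norm p (\<lambda>x. norm (f x)) = Lp_norm p f"
  by (simp add: Lp_norm_def)

text \<open>Hoelder's inequality with exponent 2p produces a norm of |V_g f|; this converts its
  square into the p-norm of the spectrogram.\<close>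

lemma Lp_norm_double_square:
  fixes u :: "'a::euclidean_space \<Rightarrow> real"
  assumes "1 \<le> p" and [measurable]: "u \<in> borel_measurable lebesgue" and nn: "\<And>x. 0 \<le> u x"
  shows "(Lp_norm (2 * p) u)\<^sup>2 \<le> Lp_norm p (\<lambda>x. (u x)\<^sup>2)"
proof (cases p)
  case top
  define S where "S = Lp_norm \<infinity> (\<lambda>x. (u x)\<^sup>2)"
  show ?thesis
  proof (cases S)
    case (real t)
    have "Lp_norm \<infinity> u \<le> ennreal (sqrt t)"
    proof -
      have "AE x in lebesgue. ennreal (norm (u x)) \<le> ennreal (sqrt t)"
        using Lp_norm_top_AE[of "\<lambda>x. (u x)\<^sup>2"] unfolding S_def[symmetric] real
        by eventually_elim (use real nn in \<open>auto simp: real_le_rsqrt ennreal_le_iff\<close>)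
      then show ?thesis
        by (auto simp: Lp_norm_def)
    qed
    then have "(Lp_norm \<infinity> u)\<^sup>2 \<le> (ennreal (sqrt t))\<^sup>2"
      by (intro power_mono) auto
    then show ?thesis
      using real top by (simp add: S_def ennreal_power ennreal_mult_eq_top_iff ennreal_top_mult)
  qed (use top in \<open>simp add: S_def ennreal_mult_top\<close>)
next
  case (real r)
  then have r: "r \<ge> 1"
    using assms(1) by (simp flip: ennreal_1)
  have 2: "2 * p = ennreal (2 * r)"
    using r real by (simp add: ennreal_mult)
  define I where "I = (\<integral>\<^sup>+x. ennreal (u x powr (2 * r)) \<partial>lebesgue)"
  have "((u x)\<^sup>2) powr r = u x powr (2 * r)" for x
    using nn[of x] powr_powr[of "u x" 2 r] by simp
  then have "Lp_norm p (\<lambda>x. (u x)\<^sup>2) = epowr I (1 / r)"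
    using r real by (simp add: Lp_norm_def I_def)
  moreover have "Lp_norm (2 * p) u = epowr I (1 / (2 * r))"
    unfolding 2 using r nn by (simp add: Lp_norm_def I_def)
  moreover have "(epowr I (1 / (2 * r)))\<^sup>2 = epowr I (1 / r)"
  proof (cases "I = \<infinity>")
    case False
    have "(enn2real I powr (1 / (2 * r)))\<^sup>2 = enn2real I powr (1 / r)"
      by (simp add: power2_eq_square flip: powr_add)
    then show ?thesis
      using False by (simp add: epowr_def ennreal_power)
  qed (simp add: epowr_def)
  ultimately show ?thesis by simp
qed

section \<open>Borel and completed Lebesgue measure, translations and essential suprema\<close>

lemma nn_integral_lebesgue_lborel: "(\<integral>\<^sup>+x. f x \<partial>lebesgue) = (\<integral>\<^sup>+x. f x \<partial>lborel)"
  by (rule nn_integral_completion)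

lemma borel_imp_lebesgue_measurable:
  "f \<in> borel_measurable borel \<Longrightarrow> f \<in> borel_measurable lebesgue"
  by (rule measurable_completion) simp

text \<open>Removes the shift by z from the second factor after Hoelder's inequality in part (a).
  For infinite p, translation invariance carries over the almost everywhere bound, and the essential
  supremum is at most any such bound.\<close>

lemma Lp_norm_translate_le:
  fixes F :: "'a::euclidean_space \<Rightarrow> 'b::real_normed_vector"
  assumes [measurable]: "(\<lambda>x. norm (F x)) \<in> borel_measurable borel"
  shows "Lp_norm p (\<lambda>x. F (x - a)) \<le> Lp_norm p F"
proof (cases "p = \<infinity>")
  case True
  have "AE x in lborel. ennreal (norm (F x)) \<le> Lp_norm \<infinity> F"
    using Lp_norm_top_AE[of F] by (simp only: AE_completion_iff)
  then have "AE x in distr lborel borel ((+) (- a)). ennreal (norm (F x)) \<le> Lp_norm \<infinity> F"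
    by (simp only: lborel_distr_plus)
  then have "AE x in lborel. ennreal (norm (F (x - a))) \<le> Lp_norm \<infinity> F"
    by (subst (asm) AE_distr_iff) auto
  then have "AE x in lebesgue. ennreal (norm (F (x - a))) \<le> Lp_norm \<infinity> F"
    by (rule AE_completion)
  moreover have "(\<lambda>x. ennreal (norm (F (x - a)))) \<in> borel_measurable lebesgue"
    by (rule borel_imp_lebesgue_measurable) measurable
  ultimately show ?thesis
    unfolding True by (subst Lp_norm_def) auto
next
  case False
  then show ?thesis
    by (simp add: Lp_norm_def nn_integral_lebesgue_lborel
        nn_integral_lborel_translate[where f="\<lambda>x. ennreal (norm (F x) powr enn2real p)"])
qed

text \<open>The points satisfying the bound form a closed set of full measure, hence the whole
  space. This turns weighted sup norms into bounds at every point.\<close>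

lemma continuous_le_Lp_norm_top:
  fixes F :: "'a::euclidean_space \<Rightarrow> 'b::real_normed_vector"
  assumes "continuous_on UNIV F"
  shows "ennreal (norm (F x)) \<le> Lp_norm \<infinity> F"
proof -
  have "closed {x. ennreal (norm (F x)) \<le> Lp_norm \<infinity> F}"
    by (intro closed_Collect_le continuous_on_ennreal continuous_on_norm assms continuous_on_const)
  then show ?thesis
    using mem_closed_if_AE_lebesgue[of "{x. ennreal (norm (F x)) \<le> Lp_norm \<infinity> F}" x] Lp_norm_top_AE[of F]
    by simp
qed

text \<open>Identifies the fourth power in the denominator of \<open>D2\<close> with the squared
  energy that arises in the estimates.\<close>

lemma Lp_norm_two_power4:
  assumes "(\<integral>\<^sup>+x. ennreal ((norm (f x))\<^sup>2) \<partial>lborel) < \<infinity>"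
  shows "(Lp_norm 2 f) ^ 4 = (\<integral>\<^sup>+x. ennreal ((norm (f x))\<^sup>2) \<partial>lborel)\<^sup>2"
proof -
  define G where "G = (\<integral>\<^sup>+x. ennreal ((norm (f x))\<^sup>2) \<partial>lborel)"
  have "Lp_norm 2 f = epowr G (1 / 2)"
    by (simp add: Lp_norm_def nn_integral_lebesgue_lborel G_def)
  also have "\<dots> = ennreal (sqrt (enn2real G))"
    using assms by (simp add: G_def epowr_def powr_half_sqrt)
  finally have "(Lp_norm 2 f) ^ 4 = ennreal ((sqrt (enn2real G)) ^ 4)"
    by (simp add: ennreal_power)
  also have "(sqrt (enn2real G)) ^ 4 = (enn2real G)\<^sup>2"
    using power_mult[of "sqrt (enn2real G)" 2 2] by simp
  also have "ennreal \<dots> = G\<^sup>2"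
    using assms by (simp add: G_def ennreal_power[symmetric])
  finally show ?thesis by (simp add: G_def)
qed

text \<open>The cancellation common to both parts, used with \<delta> = 1 - \<epsilon>.\<close>

lemma measure_ge_of_concentration:
  fixes F :: "'a \<Rightarrow> ennreal"
  assumes "E \<in> sets M" and le: "\<And>z. F z \<le> C" and "F z0 \<noteq> 0"
    and fin: "(\<integral>\<^sup>+z\<in>E. F z \<partial>M) < \<infinity>" and ge: "ennreal \<delta> * C \<le> (\<integral>\<^sup>+z\<in>E. F z \<partial>M)"
    and "0 < \<delta>"
  shows "ennreal \<delta> \<le> emeasure M E"
proof -
  have "C \<noteq> 0"
    using le[of z0] \<open>F z0 \<noteq> 0\<close> by auto
  \<comment> \<open>A positive \<delta> times infinity is infinity, so an infinite C would
    contradict the finite integral.\<close>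
  moreover have "C \<noteq> \<infinity>"
    using fin ge \<open>0 < \<delta>\<close> by (auto simp: ennreal_mult_top)
  moreover have "C * ennreal \<delta> \<le> C * emeasure M E"
  proof -
    have "(\<integral>\<^sup>+z\<in>E. F z \<partial>M) \<le> (\<integral>\<^sup>+z\<in>E. C \<partial>M)"
      by (intro nn_integral_mono mult_right_mono le) simp
    also have "\<dots> = C * emeasure M E"
      using \<open>E \<in> sets M\<close> by (simp add: nn_integral_cmult_indicator)
    finally show ?thesis
      using ge by (simp add: mult.commute)
  qed
  ultimately show ?thesis
    by (simp add: ennreal_mult_le_mult_iff)
qed

subsection \<open>The short-time Fourier transform\<close>

text \<open>The conditions that \<open>fourier_inversion\<close> puts on the function itself. By
  \<open>regular_window\<close> they pass to every windowed function whose transform is a slice of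
  the short-time transform.\<close>

definition regular :: "(real^'n::finite \<Rightarrow> complex) \<Rightarrow> bool" where
  "regular f \<longleftrightarrow> integrable lborel f \<and> continuous_on UNIV f \<and> bounded (range f)"

lemma regularD:
  assumes "regular f"
  shows "integrable lborel f" "continuous_on UNIV f" "f \<in> borel_measurable borel"
    "\<exists>B. \<forall>x. norm (f x) \<le> B"
  using assms by (auto simp: regular_def bounded_iff intro: borel_measurable_continuous_onI)

lemma stft_eq_fourier: "stft g f (x, \<xi>) = fourier (\<lambda>y. f y * cnj (g (y - x))) \<xi>"
  by (simp add: stft_def fourier_def mult_ac)

lemma borel_measurable_cnj [measurable (raw)]:
  "f \<in> borel_measurable M \<Longrightarrow> (\<lambda>x. cnj (f x)) \<in> borel_measurable M"
  by (rule measurable_compose[OF _ borel_measurable_continuous_onI]) (auto intro: continuous_intros)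

lemma stft_lborel:
  assumes [measurable]: "f \<in> borel_measurable borel" "g \<in> borel_measurable borel"
  shows "stft g f (x, \<xi>) = (LINT y|lborel. exp (- \<i> * complex_of_real (y \<bullet> \<xi>)) * (f y * cnj (g (y - x))))"
  unfolding stft_eq_fourier by (rule fourier_lborel) measurable

lemma measurable_fst_borel [measurable]:
  "(fst :: 'a::euclidean_space \<times> 'b::euclidean_space \<Rightarrow> 'a) \<in> borel_measurable borel"
  by (intro borel_measurable_continuous_onI continuous_intros)

lemma measurable_snd_borel [measurable]:
  "(snd :: 'a::euclidean_space \<times> 'b::euclidean_space \<Rightarrow> 'b) \<in> borel_measurable borel"
  by (intro borel_measurable_continuous_onI continuous_intros)

lemma nn_integral_lborel_pair:
  fixes f :: "'a::euclidean_space \<times> 'b::euclidean_space \<Rightarrow> ennreal"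
  assumes "f \<in> borel_measurable borel"
  shows "(\<integral>\<^sup>+z. f z \<partial>lborel) = (\<integral>\<^sup>+x. \<integral>\<^sup>+y. f (x, y) \<partial>lborel \<partial>lborel)"
    and "(\<integral>\<^sup>+z. f z \<partial>lborel) = (\<integral>\<^sup>+y. \<integral>\<^sup>+x. f (x, y) \<partial>lborel \<partial>lborel)"
  using lborel.nn_integral_fst[of f lborel] lborel_pair.nn_integral_snd[of f] assms
  by (simp_all add: lborel_prod)

lemma regular_window:
  assumes f: "regular f" and g: "regular g"
  shows "regular (\<lambda>y. f y * cnj (g (y - x)))"
proof -
  note [measurable] = regularD(3)[OF f] regularD(3)[OF g]
  obtain A B where A: "\<And>x. norm (f x) \<le> A" and B: "\<And>x. norm (g x) \<le> B"
    using regularD(4)[OF f] regularD(4)[OF g] by blast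
  have "A \<ge> 0"
    using A[of 0] norm_ge_zero order_trans by blast
  have "integrable lborel (\<lambda>y. f y * cnj (g (y - x)))"
  proof (rule Bochner_Integration.integrable_bound)
    show "integrable lborel (\<lambda>y. B *\<^sub>R f y)"
      using regularD(1)[OF f] by simp
    have "norm (g y) \<le> \<bar>B\<bar>" for y
      using B[of y] by linarith
    then show "AE y in lborel. norm (f y * cnj (g (y - x))) \<le> norm (B *\<^sub>R f y)"
      by (intro AE_I2) (simp add: norm_mult mult.commute[of "\<bar>B\<bar>"] mult_left_mono)
  qed measurable
  moreover have "continuous_on UNIV (\<lambda>y. f y * cnj (g (y - x)))"
    by (intro continuous_intros regularD(2)[OF f] continuous_on_compose2[OF regularD(2)[OF g]]) auto
  moreover have "bounded (range (\<lambda>y. f y * cnj (g (y - x))))"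
    using \<open>A \<ge> 0\<close> A B by (auto simp: bounded_iff norm_mult intro!: exI[of _ "A * B"] mult_mono)
  ultimately show ?thesis
    by (simp add: regular_def)
qed

text \<open>If the transform is integrable, this is the triangle inequality in the inversion
  formula; otherwise the right-hand side is infinite. The dichotomy spares a proof that windowed
  functions have integrable transforms.\<close>

lemma norm_le_nn_integral_fourier:
  fixes h :: "real^'n::finite \<Rightarrow> complex"
  assumes h: "regular h"
  shows "ennreal ((2 * pi) ^ CARD('n) * norm (h x)) \<le> (\<integral>\<^sup>+\<eta>. ennreal (norm (fourier h \<eta>)) \<partial>lborel)"
proof (cases "integrable lborel (fourier h)")
  case True
  obtain B where B: "\<And>x. norm (h x) \<le> B"
    using regularD(4)[OF h] by blast
  have i: "integrable lborel (\<lambda>\<eta>. iexp (x \<bullet> \<eta>) * fourier h \<eta>)"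
    by (rule Bochner_Integration.integrable_bound[OF True])
       (use regularD(3)[OF h] in \<open>auto simp: norm_mult\<close>)
  have "(2 * pi) ^ CARD('n) * norm (h x) = norm (LINT \<eta>|lborel. iexp (x \<bullet> \<eta>) * fourier h \<eta>)"
    by (simp add: fourier_inversion[OF regularD(1,2)[OF h] B True] norm_mult norm_power)
  then show ?thesis
    using integral_norm_bound_ennreal[OF i] by (simp add: norm_mult)
next
  case False
  then show ?thesis
    using regularD(3)[OF h] by (auto simp: integrable_iff_bounded not_less top_unique)
qed

lemma fourier_translate:
  assumes [measurable]: "g \<in> borel_measurable borel"
  shows "fourier g \<zeta> = (LINT y|lborel. iexp (- ((y - x) \<bullet> \<zeta>)) * g (y - x))"
  by (subst fourier_lborel, simp, subst lborel_integral_affine[of 1 _ "- x"]) simp_all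

text \<open>Writing the conjugate of \<open>fourier g\<close> as an integral over y and exchanging
  the integrals leaves, for each y, an inversion integral for f at y.\<close>

theorem stft_fourier:
  fixes f g :: "real^'n::finite \<Rightarrow> complex"
  assumes f: "regular f" "regular (fourier f)" and g: "regular g" "regular (fourier g)"
  shows "stft (fourier g) (fourier f) (\<xi>, - x) = (2 * pi) ^ CARD('n) * iexp (x \<bullet> \<xi>) * stft g f (x, \<xi>)"
proof -
  note [measurable] = regularD(3)[OF f(1)] regularD(3)[OF g(1)]
  obtain B where B: "\<And>x. norm (f x) \<le> B"
    using regularD(4)[OF f(1)] by blast
  let ?F = "\<lambda>\<eta> y. fourier f \<eta> * cnj (g (y - x)) * (iexp (y \<bullet> \<eta>) * iexp (- (y \<bullet> \<xi>)) * iexp (x \<bullet> \<xi>))"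
  have gx: "integrable lborel (\<lambda>y. g (y - x))"
    using lborel_integrable_affine[OF _ regularD(1)[OF g(1)], of 1 "- x"] by simp
  have "stft (fourier g) (fourier f) (\<xi>, - x) =
      (LINT \<eta>|lborel. iexp (x \<bullet> \<eta>) * (fourier f \<eta> * cnj (fourier g (\<eta> - \<xi>))))"
    by (subst stft_lborel) (simp_all add: inner_commute mult_ac)
  also have "\<dots> = (LINT \<eta>|lborel. (LINT y|lborel. ?F \<eta> y))"
  proof (intro Bochner_Integration.integral_cong refl)
    fix \<eta>
    \<comment> \<open>The integration variable is shifted by x so that the window appears as g (y -
      x), as in \<open>stft g f (x, \<xi>)\<close>.\<close>
    have "cnj (fourier g (\<eta> - \<xi>)) = (LINT y|lborel. iexp ((y - x) \<bullet> (\<eta> - \<xi>)) * cnj (g (y - x)))"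
      by (subst fourier_translate[OF regularD(3)[OF g(1)], where x=x], subst Bochner_Integration.integral_cnj[symmetric])
        (simp add: exp_cnj)
    then have "iexp (x \<bullet> \<eta>) * (fourier f \<eta> * cnj (fourier g (\<eta> - \<xi>))) =
       (LINT y|lborel. (iexp (x \<bullet> \<eta>) * fourier f \<eta>) * (iexp ((y - x) \<bullet> (\<eta> - \<xi>)) * cnj (g (y - x))))"
      by (simp add: mult.assoc)
    also have "\<dots> = (LINT y|lborel. ?F \<eta> y)"
    proof (intro Bochner_Integration.integral_cong refl)
      fix y
      \<comment> \<open>The terms \<open>x \<bullet> \<eta>\<close> cancel, so \<eta> survives only
        in the character needed for inversion at y.\<close>
      have phase: "iexp (x \<bullet> \<eta>) * iexp ((y - x) \<bullet> (\<eta> - \<xi>)) = iexp (y \<bullet> \<eta>) * iexp (- (y \<bullet> \<xi>)) * iexp (x \<bullet> \<xi>)"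
        unfolding exp_add[symmetric] by (simp add: inner_diff_left inner_diff_right algebra_simps)
      show "(iexp (x \<bullet> \<eta>) * fourier f \<eta>) * (iexp ((y - x) \<bullet> (\<eta> - \<xi>)) * cnj (g (y - x))) = ?F \<eta> y"
        unfolding phase[symmetric] by (simp only: mult_ac)
    qed
    finally show "iexp (x \<bullet> \<eta>) * (fourier f \<eta> * cnj (fourier g (\<eta> - \<xi>))) = (LINT y|lborel. ?F \<eta> y)" .
  qed
  also have "\<dots> = (LINT y|lborel. (LINT \<eta>|lborel. ?F \<eta> y))"
  proof (rule lborel_pair.Fubini_integral[symmetric], rule lborel_pair.Fubini_integrable)
    have "integrable lborel (\<lambda>y. ?F \<eta> y)" for \<eta>
      by (rule Bochner_Integration.integrable_bound[OF integrable_mult_right[OF gx, of "fourier f \<eta>"]])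
         (auto simp: norm_mult)
    then show "AE \<eta> in lborel. integrable lborel (\<lambda>y. case (\<eta>, y) of (\<eta>, y) \<Rightarrow> ?F \<eta> y)"
      by simp
    have "integrable lborel (\<lambda>\<eta>. norm (fourier f \<eta>) * (LINT y|lborel. norm (g (y - x))))"
      by (intro integrable_mult_left integrable_norm regularD(1)[OF f(2)])
    then show "integrable lborel (\<lambda>\<eta>. LINT y|lborel. norm (case (\<eta>, y) of (\<eta>, y) \<Rightarrow> ?F \<eta> y))"
      by (simp add: norm_mult)
  qed measurable
  also have "\<dots> = (LINT y|lborel. ((2 * pi) ^ CARD('n) * iexp (x \<bullet> \<xi>)) * (exp (- \<i> * complex_of_real (y \<bullet> \<xi>)) * (f y * cnj (g (y - x)))))"
  proof (intro Bochner_Integration.integral_cong refl)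
    fix y
    have "(LINT \<eta>|lborel. ?F \<eta> y) =
      (LINT \<eta>|lborel. (cnj (g (y - x)) * iexp (- (y \<bullet> \<xi>)) * iexp (x \<bullet> \<xi>)) * (iexp (y \<bullet> \<eta>) * fourier f \<eta>))"
      by (intro Bochner_Integration.integral_cong refl) (simp only: mult_ac)
    also have "\<dots> = cnj (g (y - x)) * iexp (- (y \<bullet> \<xi>)) * iexp (x \<bullet> \<xi>) * ((2 * pi) ^ CARD('n) * f y)"
      by (simp only: integral_mult_right_zero fourier_inversion[OF regularD(1,2)[OF f(1)] B regularD(1)[OF f(2)]])
    finally show "(LINT \<eta>|lborel. ?F \<eta> y) =
       ((2 * pi) ^ CARD('n) * iexp (x \<bullet> \<xi>)) * (exp (- \<i> * complex_of_real (y \<bullet> \<xi>)) * (f y * cnj (g (y - x))))"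
      by (simp add: mult_ac)
  qed
  also have "\<dots> = (2 * pi) ^ CARD('n) * iexp (x \<bullet> \<xi>) * stft g f (x, \<xi>)"
    by (subst stft_lborel) simp_all
  finally show ?thesis .
qed

lemma norm_stft_fourier:
  fixes f g :: "real^'n::finite \<Rightarrow> complex"
  assumes "regular f" "regular (fourier f)" "regular g" "regular (fourier g)"
  shows "norm (stft (fourier g) (fourier f) (\<xi>, - x)) = (2 * pi) ^ CARD('n) * norm (stft g f (x, \<xi>))"
  by (simp add: stft_fourier[OF assms] norm_mult norm_power)

text \<open>The energy of g is the value at the origin of its short-time transform with itself as
  window, so Plancherel's identity becomes \<open>stft_fourier\<close> at the origin.\<close>

lemma regular_square:
  assumes g: "regular g"
  shows "stft g g (0, 0) = of_real (LINT y|lborel. (norm (g y))\<^sup>2)"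
    and "ennreal (LINT y|lborel. (norm (g y))\<^sup>2) = (\<integral>\<^sup>+y. ennreal ((norm (g y))\<^sup>2) \<partial>lborel)"
proof -
  note [measurable] = regularD(3)[OF g]
  have eq: "g y * cnj (g (y - 0)) = of_real ((norm (g y))\<^sup>2)" for y
    by (simp only: diff_0_right complex_norm_square)
  have "integrable lborel (\<lambda>y. complex_of_real ((norm (g y))\<^sup>2))"
    using regularD(1)[OF regular_window[OF g g, of 0]] by (simp only: eq)
  then have "integrable lborel (\<lambda>y. (norm (g y))\<^sup>2)"
    by (simp only: complex_of_real_integrable_eq)
  then show "ennreal (LINT y|lborel. (norm (g y))\<^sup>2) = (\<integral>\<^sup>+y. ennreal ((norm (g y))\<^sup>2) \<partial>lborel)"
    by (simp add: nn_integral_eq_integral)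
  show "stft g g (0, 0) = of_real (LINT y|lborel. (norm (g y))\<^sup>2)"
    unfolding stft_eq_fourier eq by (subst fourier_lborel) (simp_all del: of_real_power)
qed

lemma plancherel:
  fixes g :: "real^'n::finite \<Rightarrow> complex"
  assumes g: "regular g" "regular (fourier g)"
  shows "(\<integral>\<^sup>+y. ennreal ((norm (fourier g y))\<^sup>2) \<partial>lborel) =
    ennreal ((2 * pi) ^ CARD('n)) * (\<integral>\<^sup>+y. ennreal ((norm (g y))\<^sup>2) \<partial>lborel)"
proof -
  have "of_real (LINT y|lborel. (norm (fourier g y))\<^sup>2) =
      complex_of_real ((2 * pi) ^ CARD('n) * (LINT y|lborel. (norm (g y))\<^sup>2))"
    using stft_fourier[OF g g, of 0 0] regular_square(1)[OF g(1)] regular_square(1)[OF g(2)] by simp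
  then have "(LINT y|lborel. (norm (fourier g y))\<^sup>2) = (2 * pi) ^ CARD('n) * (LINT y|lborel. (norm (g y))\<^sup>2)"
    by (simp only: of_real_eq_iff)
  then show ?thesis
    by (simp add: regular_square(2)[OF g(1), symmetric] regular_square(2)[OF g(2), symmetric] ennreal_mult')
qed

lemma stft_measurable [measurable]:
  assumes [measurable]: "f \<in> borel_measurable borel" "g \<in> borel_measurable borel"
  shows "stft g f \<in> borel_measurable borel"
proof -
  have "stft g f = (\<lambda>z. LINT y|lborel. exp (- \<i> * complex_of_real (y \<bullet> snd z)) * (f y * cnj (g (y - fst z))))"
    by (simp add: fun_eq_iff stft_lborel[OF assms])
  then show ?thesis
    by simp
qed

lemma norm_stft_le:
  assumes f: "regular f" and g: "regular g"
  shows "ennreal (norm (stft g f (x, \<xi>))) \<le> (\<integral>\<^sup>+y. ennreal (norm (f y) * norm (g (y - x))) \<partial>lborel)"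
proof -
  note w = regular_window[OF f g, of x]
  note [measurable] = regularD(3)[OF w]
  have i: "integrable lborel (\<lambda>y. exp (- \<i> * complex_of_real (y \<bullet> \<xi>)) * (f y * cnj (g (y - x))))"
    by (rule Bochner_Integration.integrable_bound[OF regularD(1)[OF w]]) (auto simp: norm_mult)
  show ?thesis
    unfolding stft_eq_fourier using integral_norm_bound_ennreal[OF i]
    by (simp add: fourier_lborel norm_mult)
qed

lemma norm_le_stft:
  fixes f g :: "real^'n::finite \<Rightarrow> complex"
  assumes f: "regular f" and g: "regular g"
  shows "ennreal ((2 * pi) ^ CARD('n) * norm (f x)) * (\<integral>\<^sup>+y. ennreal ((norm (g y))\<^sup>2) \<partial>lborel)
    \<le> (\<integral>\<^sup>+z. ennreal (norm (stft g f z) * norm (g (x - fst z))) \<partial>lborel)"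
proof -
  note [measurable] = regularD(3)[OF f] regularD(3)[OF g]
  \<comment> \<open>Reflecting y to x - y writes the energy of g as an integral over all window
    positions y.\<close>
  have "ennreal ((2 * pi) ^ CARD('n) * norm (f x)) * (\<integral>\<^sup>+y. ennreal ((norm (g y))\<^sup>2) \<partial>lborel)
     = ennreal ((2 * pi) ^ CARD('n) * norm (f x)) * (\<integral>\<^sup>+y. ennreal ((norm (g (x - y)))\<^sup>2) \<partial>lborel)"
    by (subst nn_integral_lborel_reflect[where a=x and f="\<lambda>y. ennreal ((norm (g y))\<^sup>2)"]) simp_all
  also have "\<dots> = (\<integral>\<^sup>+y. ennreal ((2 * pi) ^ CARD('n) * norm (f x * cnj (g (x - y)))) * ennreal (norm (g (x - y))) \<partial>lborel)"
    by (subst nn_integral_cmult[symmetric], measurable)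
       (simp add: ennreal_mult'[symmetric] norm_mult power2_eq_square mult_ac)
  \<comment> \<open>For each position y, the windowed function takes the value f x times the
    conjugate of g (x - y) at x, and \<open>norm_le_nn_integral_fourier\<close> bounds it.\<close>
  also have "\<dots> \<le> (\<integral>\<^sup>+y. (\<integral>\<^sup>+\<eta>. ennreal (norm (stft g f (y, \<eta>))) \<partial>lborel) * ennreal (norm (g (x - y))) \<partial>lborel)"
    unfolding stft_eq_fourier
    by (intro nn_integral_mono mult_right_mono norm_le_nn_integral_fourier regular_window f g) simp
  also have "\<dots> = (\<integral>\<^sup>+y. (\<integral>\<^sup>+\<eta>. ennreal (norm (stft g f (y, \<eta>)) * norm (g (x - y))) \<partial>lborel) \<partial>lborel)"
    by (simp add: nn_integral_multc[symmetric] ennreal_mult')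
  also have "\<dots> = (\<integral>\<^sup>+z. ennreal (norm (stft g f z) * norm (g (x - fst z))) \<partial>lborel)"
    by (subst nn_integral_lborel_pair(1)) simp_all
  finally show ?thesis .
qed

text \<open>This is \<open>norm_le_stft\<close> for the transforms. Plancherel's identity supplies
  one more factor (2 pi)^N on the left and \<open>norm_stft_fourier\<close> the same factor on the
  right, after a reflection in the second variable; they cancel.\<close>

lemma norm_fourier_le_stft:
  fixes f g :: "real^'n::finite \<Rightarrow> complex"
  assumes f: "regular f" "regular (fourier f)" and g: "regular g" "regular (fourier g)"
  shows "ennreal ((2 * pi) ^ CARD('n) * norm (fourier f \<xi>)) * (\<integral>\<^sup>+y. ennreal ((norm (g y))\<^sup>2) \<partial>lborel)
    \<le> (\<integral>\<^sup>+z. ennreal (norm (stft g f z) * norm (fourier g (\<xi> - snd z))) \<partial>lborel)"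
proof -
  let ?c = "ennreal ((2 * pi) ^ CARD('n))"
  note [measurable] = regularD(3)[OF f(1)] regularD(3)[OF g(1)]
  have "?c * (ennreal ((2 * pi) ^ CARD('n) * norm (fourier f \<xi>)) * (\<integral>\<^sup>+y. ennreal ((norm (g y))\<^sup>2) \<partial>lborel))
    = ennreal ((2 * pi) ^ CARD('n) * norm (fourier f \<xi>)) * (\<integral>\<^sup>+y. ennreal ((norm (fourier g y))\<^sup>2) \<partial>lborel)"
    by (simp add: plancherel[OF g] mult_ac)
  also have "\<dots> \<le> (\<integral>\<^sup>+z. ennreal (norm (stft (fourier g) (fourier f) z) * norm (fourier g (\<xi> - fst z))) \<partial>lborel)"
    by (rule norm_le_stft[OF f(2) g(2)])
  also have "\<dots> = (\<integral>\<^sup>+\<eta>. \<integral>\<^sup>+y. ennreal (norm (stft (fourier g) (fourier f) (\<eta>, y)) * norm (fourier g (\<xi> - \<eta>))) \<partial>lborel \<partial>lborel)"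
    by (subst nn_integral_lborel_pair(1)) simp_all
  also have "\<dots> = (\<integral>\<^sup>+\<eta>. \<integral>\<^sup>+y. ennreal (norm (stft (fourier g) (fourier f) (\<eta>, 0 - y)) * norm (fourier g (\<xi> - \<eta>))) \<partial>lborel \<partial>lborel)"
    by (subst nn_integral_lborel_reflect) simp_all
  also have "\<dots> = (\<integral>\<^sup>+\<eta>. \<integral>\<^sup>+y. ?c * ennreal (norm (stft g f (y, \<eta>)) * norm (fourier g (\<xi> - \<eta>))) \<partial>lborel \<partial>lborel)"
    by (simp add: norm_stft_fourier[OF f g] ennreal_mult'[symmetric] mult.assoc)
  also have "\<dots> = ?c * (\<integral>\<^sup>+\<eta>. \<integral>\<^sup>+y. ennreal (norm (stft g f (y, \<eta>)) * norm (fourier g (\<xi> - \<eta>))) \<partial>lborel \<partial>lborel)"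
    by (simp add: nn_integral_cmult)
  also have "(\<integral>\<^sup>+\<eta>. \<integral>\<^sup>+y. ennreal (norm (stft g f (y, \<eta>)) * norm (fourier g (\<xi> - \<eta>))) \<partial>lborel \<partial>lborel)
     = (\<integral>\<^sup>+z. ennreal (norm (stft g f z) * norm (fourier g (\<xi> - snd z))) \<partial>lborel)"
    by (subst nn_integral_lborel_pair(2)) simp_all
  finally show ?thesis
    by (subst (asm) ennreal_mult_le_mult_iff) (auto simp: ennreal_eq_0_iff not_le)
qed

text \<open>One factor of |V_g f|^2 is estimated in time; the other, moved to the Fourier side at
  the price of (2 pi)^N, is estimated in frequency. The product of the two integrals is one integral
  over phase space.\<close>

lemma spectrogram_le:
  fixes f g :: "real^'n::finite \<Rightarrow> complex"
  assumes f: "regular f" "regular (fourier f)" and g: "regular g" "regular (fourier g)"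
  shows "ennreal ((2 * pi) ^ CARD('n) * spectrogram g f z)
    \<le> (\<integral>\<^sup>+w. ennreal (norm (rihaczek f w) * norm (rihaczek g (w - z))) \<partial>lborel)"
proof -
  note [measurable] = regularD(3)[OF f(1)] regularD(3)[OF g(1)]
  obtain x \<xi> where z: "z = (x, \<xi>)" by fastforce
  have "ennreal ((2 * pi) ^ CARD('n) * spectrogram g f z) =
      ennreal (norm (stft g f (x, \<xi>))) * ennreal (norm (stft (fourier g) (fourier f) (\<xi>, - x)))"
    by (simp add: norm_stft_fourier[OF f g] z spectrogram_def power2_eq_square ennreal_mult'[symmetric] mult_ac)
  also have "\<dots> \<le> (\<integral>\<^sup>+y. ennreal (norm (f y) * norm (g (y - x))) \<partial>lborel) *
      (\<integral>\<^sup>+\<eta>. ennreal (norm (fourier f \<eta>) * norm (fourier g (\<eta> - \<xi>))) \<partial>lborel)"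
    by (intro mult_mono norm_stft_le f g) auto
  also have "\<dots> = (\<integral>\<^sup>+y. \<integral>\<^sup>+\<eta>. ennreal (norm (f y) * norm (g (y - x))) * ennreal (norm (fourier f \<eta>) * norm (fourier g (\<eta> - \<xi>))) \<partial>lborel \<partial>lborel)"
    by (simp add: nn_integral_cmult nn_integral_multc)
  also have "\<dots> = (\<integral>\<^sup>+y. \<integral>\<^sup>+\<eta>. ennreal (norm (rihaczek f (y, \<eta>)) * norm (rihaczek g ((y, \<eta>) - z))) \<partial>lborel \<partial>lborel)"
    by (simp add: z rihaczek_def norm_mult ennreal_mult'[symmetric] mult_ac)
  also have "\<dots> = (\<integral>\<^sup>+w. ennreal (norm (rihaczek f w) * norm (rihaczek g (w - z))) \<partial>lborel)"
    by (subst nn_integral_lborel_pair(1))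
       (simp_all add: rihaczek_def split_beta')
  finally show ?thesis .
qed

lemma rihaczek_measurable [measurable]:
  assumes [measurable]: "f \<in> borel_measurable borel"
  shows "rihaczek f \<in> borel_measurable borel"
  unfolding rihaczek_def split_beta' by measurable

lemma norm_rihaczek: "norm (rihaczek f z) = norm (f (fst z)) * norm (fourier f (snd z))"
  by (simp add: rihaczek_def split_beta' norm_mult)

text \<open>A continuous function vanishing almost everywhere vanishes identically. The two claims
  together permit division by the energy of g.\<close>

lemma regular_nonzero:
  assumes g: "regular g" and "g \<noteq> (\<lambda>_. 0)"
  shows "(\<integral>\<^sup>+y. ennreal ((norm (g y))\<^sup>2) \<partial>lborel) \<noteq> 0"
    and "(\<integral>\<^sup>+y. ennreal ((norm (g y))\<^sup>2) \<partial>lborel) < \<infinity>"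
proof -
  note [measurable] = regularD(3)[OF g]
  show "(\<integral>\<^sup>+y. ennreal ((norm (g y))\<^sup>2) \<partial>lborel) \<noteq> 0"
  proof
    assume "(\<integral>\<^sup>+y. ennreal ((norm (g y))\<^sup>2) \<partial>lborel) = 0"
    then have "AE y in lborel. y \<in> {y. g y = 0}"
      by (subst (asm) nn_integral_0_iff_AE) auto
    moreover have "closed {y. g y = 0}"
      by (intro closed_Collect_eq regularD(2)[OF g] continuous_on_const)
    ultimately have "g y = 0" for y
      using mem_closed_if_AE_lebesgue[of "{y. g y = 0}" y] by (simp add: AE_completion)
    then show False
      using assms(2) by auto
  qed
  show "(\<integral>\<^sup>+y. ennreal ((norm (g y))\<^sup>2) \<partial>lborel) < \<infinity>"
    by (simp flip: regular_square(2)[OF g])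
qed

text \<open>If the transform vanished, \<open>norm_le_nn_integral_fourier\<close> would force f to
  vanish everywhere.\<close>

lemma fourier_nonzero:
  fixes f :: "real^'n::finite \<Rightarrow> complex"
  assumes f: "regular f" and "f \<noteq> (\<lambda>_. 0)"
  obtains \<xi> where "fourier f \<xi> \<noteq> 0"
proof -
  obtain x where "f x \<noteq> 0"
    using assms(2) by auto
  have pos: "\<not> pi ^ CARD('n) \<le> 0" "\<not> (2::real) ^ CARD('n) \<le> 0"
    by (simp_all add: not_le)
  have False if "\<And>\<xi>. fourier f \<xi> = 0"
    using norm_le_nn_integral_fourier[OF f, of x] \<open>f x \<noteq> 0\<close>
    by (simp add: that ennreal_eq_0_iff mult_le_0_iff pos)
  then show ?thesis
    using that by blast
qed

text \<open>If the transform vanished, the right-hand side of \<open>norm_le_stft\<close> would be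
  0, while its left-hand side is positive wherever f is nonzero, because g has nonzero
  energy.\<close>

lemma stft_nonzero:
  fixes f g :: "real^'n::finite \<Rightarrow> complex"
  assumes f: "regular f" "f \<noteq> (\<lambda>_. 0)" and g: "regular g" "g \<noteq> (\<lambda>_. 0)"
  obtains z where "stft g f z \<noteq> 0"
proof -
  obtain x where "f x \<noteq> 0"
    using f(2) by auto
  have pos: "\<not> pi ^ CARD('n) \<le> 0" "\<not> (2::real) ^ CARD('n) \<le> 0"
    by (simp_all add: not_le)
  have False if "\<And>z. stft g f z = 0"
    using norm_le_stft[OF f(1) g(1), of x] regular_nonzero(1)[OF g] \<open>f x \<noteq> 0\<close>
    by (simp add: that ennreal_eq_0_iff mult_le_0_iff pos)
  then show ?thesis
    using that by blast
qed

subsection \<open>Weights\<close>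

lemma norm_Pair_bounds:
  "norm x \<le> norm (x, y)" "norm y \<le> norm (x, y)" "norm (x, y) \<le> norm x + norm y"
  by (simp_all add: norm_Pair sqrt_add_le_add_sqrt[of "(norm x)\<^sup>2" "(norm y)\<^sup>2", simplified])

text \<open>Each coordinate satisfies 1 + x_b^2 \<le> (1 + |x|)^2, so the integrand is at most a
  product of one-dimensional integrable functions 1 / (1 + x_b^2). The exponent 2N makes this work
  without polar coordinates.\<close>

lemma nn_integral_inverse_norm_power:
  "(\<integral>\<^sup>+(x::'a::euclidean_space). ennreal (inverse ((1 + norm x) ^ (2 * DIM('a)))) \<partial>lborel) < \<infinity>"
proof -
  have "integrable lborel (\<lambda>x::real. inverse (1 + x\<^sup>2))"
    using integrable_inverse_1_plus_square by (simp add: set_integrable_def)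
  then have "(\<integral>\<^sup>+(x::real). ennreal (norm (inverse (1 + x\<^sup>2))) \<partial>lborel) < \<infinity>"
    by (simp add: integrable_iff_bounded)
  then have fin: "(\<integral>\<^sup>+(x::real). ennreal (inverse (1 + x\<^sup>2)) \<partial>lborel) < \<infinity>"
    by simp
  have le: "inverse ((1 + norm x) ^ (2 * DIM('a))) \<le> (\<Prod>b\<in>Basis. inverse (1 + (x \<bullet> b)\<^sup>2))" for x :: 'a
  proof -
    have "(\<Prod>b\<in>Basis. 1 + (x \<bullet> b)\<^sup>2) \<le> (\<Prod>b\<in>(Basis::'a set). (1 + norm x)\<^sup>2)"
    proof (rule prod_mono)
      fix b :: 'a assume "b \<in> Basis"
      then have "(x \<bullet> b)\<^sup>2 \<le> (norm x)\<^sup>2"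
        using Basis_le_norm by (simp add: abs_le_square_iff[symmetric])
      then show "0 \<le> 1 + (x \<bullet> b)\<^sup>2 \<and> 1 + (x \<bullet> b)\<^sup>2 \<le> (1 + norm x)\<^sup>2"
        by (auto simp: power2_sum intro: add_nonneg_nonneg add_mono order_trans)
    qed
    also have "\<dots> = (1 + norm x) ^ (2 * DIM('a))"
      by (simp add: power_mult)
    finally have "inverse ((1 + norm x) ^ (2 * DIM('a))) \<le> inverse (\<Prod>b\<in>Basis. 1 + (x \<bullet> b)\<^sup>2)"
      by (intro le_imp_inverse_le prod_pos) (auto intro: add_pos_nonneg)
    then show ?thesis
      by (simp add: prod_inversef[symmetric] o_def)
  qed
  have "(\<integral>\<^sup>+(x::'a). ennreal (inverse ((1 + norm x) ^ (2 * DIM('a)))) \<partial>lborel)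
     \<le> (\<integral>\<^sup>+(x::'a). (\<Prod>b\<in>Basis. ennreal (inverse (1 + (x \<bullet> b)\<^sup>2))) \<partial>lborel)"
    by (intro nn_integral_mono) (simp add: prod_ennreal le ennreal_leI)
  also have "\<dots> = (\<Prod>b\<in>(Basis::'a set). \<integral>\<^sup>+(x::real). ennreal (inverse (1 + x\<^sup>2)) \<partial>lborel)"
    by (rule nn_integral_lborel_prod) auto
  also have "\<dots> < \<infinity>"
    using fin by (simp add: power_less_top_ennreal)
  finally show ?thesis .
qed

locale weight =
  fixes \<omega> :: "real \<Rightarrow> real" and K b :: real
  assumes weight: "weight_function \<omega> K b"
begin

lemma K_ge_1: "1 \<le> K"
  using weight by (simp add: weight_function_def)

lemma weight_nonneg: "0 \<le> \<omega> (norm z)"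
  using weight by (simp add: weight_function_def)

lemma weight_mono: "s \<le> t \<Longrightarrow> 0 \<le> s \<Longrightarrow> \<omega> s \<le> \<omega> t"
  using weight by (auto simp: weight_function_def mono_on_def)

lemma weight_continuous: "continuous_on UNIV (\<lambda>z. \<omega> (norm z))"
proof (rule continuous_on_compose2[where t="{0..}" and g=\<omega> and f=norm])
  show "continuous_on {0..} \<omega>"
    using weight by (simp add: weight_function_def)
qed (auto intro: continuous_on_norm_id)

lemma weight_measurable [measurable]: "(\<lambda>z::'a::euclidean_space. \<omega> (norm z)) \<in> borel_measurable borel"
  by (intro borel_measurable_continuous_onI weight_continuous)

text \<open>Since s + t \<le> 2 max s t, monotonicity and the doubling condition apply, and the
  weight of the maximum is at most the sum of the weights.\<close>

lemma weight_quasi_subadditive: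
  assumes "0 \<le> r" "0 \<le> s" "0 \<le> t" "r \<le> s + t"
  shows "\<omega> r \<le> K * (1 + \<omega> s + \<omega> t)"
proof -
  have "\<omega> r \<le> \<omega> (2 * max s t)"
    using assms by (intro weight_mono) auto
  also have "\<dots> \<le> K * (1 + \<omega> (max s t))"
    using assms weight by (simp add: weight_function_def)
  also have "\<dots> \<le> K * (1 + \<omega> s + \<omega> t)"
    using assms K_ge_1 weight_nonneg[of s] weight_nonneg[of t]
    by (intro mult_left_mono) (auto simp: max_def)
  finally show ?thesis .
qed

lemma exp_weight_le:
  assumes "0 \<le> l" "0 \<le> r" "0 \<le> s" "0 \<le> t" "r \<le> s + t"
  shows "exp (l * \<omega> r) \<le> exp (K * l) * exp (K * l * \<omega> s) * exp (K * l * \<omega> t)"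
proof -
  have "l * \<omega> r \<le> l * (K * (1 + \<omega> s + \<omega> t))"
    using assms by (intro mult_left_mono weight_quasi_subadditive)
  also have "\<dots> = K * l + K * l * \<omega> s + K * l * \<omega> t"
    by (simp add: algebra_simps)
  finally show ?thesis
    by (simp add: exp_add[symmetric])
qed

lemma exp_weighted_continuous:
  "continuous_on UNIV F \<Longrightarrow> continuous_on UNIV (exp_weighted \<omega> l F)"
  unfolding exp_weighted_def by (intro continuous_intros weight_continuous)

lemma norm_exp_weighted: "norm (exp_weighted \<omega> l F z) = exp (l * \<omega> (norm z)) * norm (F z)"
  by (simp add: exp_weighted_def)

lemma exp_weight_integrable:
  obtains L where "L > 0" "(\<integral>\<^sup>+(x::'a::euclidean_space). ennreal (exp (- L * \<omega> (norm x))) \<partial>lborel) < \<infinity>"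
proof -
  obtain a where b: "b > 0" and a: "\<And>t. t \<ge> 0 \<Longrightarrow> a + b * ln (1 + t) \<le> \<omega> t"
    using weight by (auto simp: weight_function_def)
  \<comment> \<open>Chosen so that L b is twice the dimension: the logarithmic lower bound then
    gives decay of order (1 + |x|)^(-2 DIM), as required by
    \<open>nn_integral_inverse_norm_power\<close>.\<close>
  define L where "L = 2 * real DIM('a) / b"
  have "L > 0"
    using b by (simp add: L_def)
  have "exp (- L * \<omega> (norm x)) \<le> exp (- L * a) * inverse ((1 + norm x) ^ (2 * DIM('a)))" for x :: 'a
  proof -
    have "L * (a + b * ln (1 + norm x)) \<le> L * \<omega> (norm x)"
      using \<open>L > 0\<close> by (intro mult_left_mono a) auto
    moreover have "L * (a + b * ln (1 + norm x)) = L * a + real (2 * DIM('a)) * ln (1 + norm x)"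
      using b by (simp add: L_def field_simps)
    ultimately have "exp (- L * \<omega> (norm x)) \<le> exp (- L * a - real (2 * DIM('a)) * ln (1 + norm x))"
      by simp
    also have "\<dots> = exp (- L * a) * inverse (exp (real (2 * DIM('a)) * ln (1 + norm x)))"
      by (simp add: exp_diff field_simps)
    also have "exp (real (2 * DIM('a)) * ln (1 + norm x)) = (1 + norm x) ^ (2 * DIM('a))"
      by (subst exp_of_nat_mult) (simp add: add_pos_nonneg)
    finally show ?thesis .
  qed
  then have "(\<integral>\<^sup>+(x::'a). ennreal (exp (- L * \<omega> (norm x))) \<partial>lborel)
     \<le> (\<integral>\<^sup>+(x::'a). ennreal (exp (- L * a)) * ennreal (inverse ((1 + norm x) ^ (2 * DIM('a)))) \<partial>lborel)"
    by (intro nn_integral_mono) (simp add: ennreal_mult'[symmetric])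
  also have "\<dots> = ennreal (exp (- L * a)) * (\<integral>\<^sup>+(x::'a). ennreal (inverse ((1 + norm x) ^ (2 * DIM('a)))) \<partial>lborel)"
    by (rule nn_integral_cmult) measurable
  also have "\<dots> < \<infinity>"
    using nn_integral_inverse_norm_power[where 'a='a] by (simp add: ennreal_mult_less_top)
  finally show ?thesis
    using that \<open>L > 0\<close> by blast
qed

text \<open>All of \<open>S_omega\<close> that is needed: the decay of the functions, without their derivatives.\<close>

definition rapid :: "(real^'n::finite \<Rightarrow> complex) \<Rightarrow> bool" where
  "rapid f \<longleftrightarrow> continuous_on UNIV f \<and> (\<forall>l>0. Lp_norm \<infinity> (exp_weighted \<omega> l f) < \<infinity>)"

lemma S_omega_rapid:
  assumes "f \<in> S_omega \<omega>" shows "rapid f" "rapid (fourier f)"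
proof -
  \<comment> \<open>The empty list of derivatives is the function itself.\<close>
  have "continuous_on UNIV (partials [] f)" "continuous_on UNIV (partials [] (fourier f))"
    using assms unfolding S_omega_def smooth_def by blast+
  moreover have "Lp_norm \<infinity> (exp_weighted \<omega> l (partials [] f)) < \<infinity>"
    "Lp_norm \<infinity> (exp_weighted \<omega> l (partials [] (fourier f))) < \<infinity>" if "l > 0" for l
    using assms that unfolding S_omega_def by blast+
  ultimately show "rapid f" "rapid (fourier f)"
    by (simp_all add: rapid_def partials_def)
qed

lemma rapid_bound:
  assumes "rapid f" "l > 0"
  obtains C where "\<And>x. exp (l * \<omega> (norm x)) * norm (f x) \<le> C"
proof -
  have fin: "Lp_norm \<infinity> (exp_weighted \<omega> l f) < \<infinity>" and c: "continuous_on UNIV f"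
    using assms by (auto simp: rapid_def)
  obtain C where C: "0 \<le> C" "Lp_norm \<infinity> (exp_weighted \<omega> l f) = ennreal C"
    using fin by (cases "Lp_norm \<infinity> (exp_weighted \<omega> l f)") auto
  have "exp (l * \<omega> (norm x)) * norm (f x) \<le> C" for x
    using continuous_le_Lp_norm_top[OF exp_weighted_continuous[OF c, of l], of x] C
    by (simp add: norm_exp_weighted)
  then show ?thesis
    using that by blast
qed

text \<open>The decay hypothesis is used with the larger exponent c + L; the surplus leaves the
  integrable factor from \<open>exp_weight_integrable\<close>.\<close>

lemma rapid_weighted_integrable:
  fixes f :: "real^'n::finite \<Rightarrow> complex"
  assumes "rapid f" "0 \<le> c"
  shows "(\<integral>\<^sup>+x. ennreal (exp (c * \<omega> (norm x)) * norm (f x)) \<partial>lborel) < \<infinity>"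
proof -
  obtain L where L: "L > 0" "(\<integral>\<^sup>+(x::real^'n). ennreal (exp (- L * \<omega> (norm x))) \<partial>lborel) < \<infinity>"
    by (rule exp_weight_integrable)
  obtain C where C: "\<And>x. exp ((c + L) * \<omega> (norm x)) * norm (f x) \<le> C"
    using rapid_bound[OF assms(1), of "c + L"] assms(2) L by auto
  have "C \<ge> 0"
    using C[of 0] order_trans[of 0 "exp ((c + L) * \<omega> (norm 0)) * norm (f 0)" C] by simp
  have "exp (c * \<omega> (norm x)) * norm (f x) \<le> C * exp (- L * \<omega> (norm x))" for x
  proof -
    have "exp (c * \<omega> (norm x)) = exp ((c + L) * \<omega> (norm x)) * exp (- L * \<omega> (norm x))"
      by (simp add: exp_add[symmetric] algebra_simps)
    then show ?thesis
      using mult_right_mono[OF C[of x], of "exp (- L * \<omega> (norm x))"] by (simp add: mult_ac)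
  qed
  then have "(\<integral>\<^sup>+x. ennreal (exp (c * \<omega> (norm x)) * norm (f x)) \<partial>lborel)
     \<le> (\<integral>\<^sup>+(x::real^'n). ennreal C * ennreal (exp (- L * \<omega> (norm x))) \<partial>lborel)"
    using \<open>C \<ge> 0\<close> by (intro nn_integral_mono) (simp add: ennreal_mult[symmetric])
  also have "\<dots> = ennreal C * (\<integral>\<^sup>+(x::real^'n). ennreal (exp (- L * \<omega> (norm x))) \<partial>lborel)"
    by (rule nn_integral_cmult) measurable
  also have "\<dots> < \<infinity>"
    using L by (simp add: ennreal_mult_less_top)
  finally show ?thesis .
qed

lemma rapid_regular:
  assumes "rapid f" shows "regular f"
proof -
  have c: "continuous_on UNIV f"
    using assms by (simp add: rapid_def)
  moreover have "integrable lborel f"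
    using rapid_weighted_integrable[OF assms, of 0] borel_measurable_continuous_onI[OF c]
    by (simp add: integrable_iff_bounded)
  moreover obtain C where C: "\<And>x. exp (1 * \<omega> (norm x)) * norm (f x) \<le> C"
    using rapid_bound[OF assms, of 1] by auto
  have "norm (f x) \<le> C" for x
  proof -
    have "1 * norm (f x) \<le> exp (1 * \<omega> (norm x)) * norm (f x)"
      using weight_nonneg[of x] by (intro mult_right_mono) auto
    then show ?thesis using C[of x] by simp
  qed
  ultimately show ?thesis
    by (auto simp: regular_def bounded_iff)
qed

lemma S_omega_regular:
  assumes "f \<in> S_omega \<omega>" shows "regular f" "regular (fourier f)"
  using S_omega_rapid[OF assms] by (simp_all add: rapid_regular)

text \<open>Quasi-subadditivity separates the weight at (x, \<xi>) into weights in x and in \<xi>,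
  and |Rf| is itself a product, so the integral is bounded by a product of two finite ones.\<close>

lemma rihaczek_weighted_integrable:
  fixes f :: "real^'n::finite \<Rightarrow> complex"
  assumes f: "f \<in> S_omega \<omega>" and "0 \<le> c"
  shows "(\<integral>\<^sup>+z. ennreal (exp (c * \<omega> (norm z)) * norm (rihaczek f z)) \<partial>lborel) < \<infinity>"
proof -
  note [measurable] = regularD(3)[OF S_omega_regular(1)[OF f]]
  let ?u = "\<lambda>x. ennreal (exp (K * c * \<omega> (norm x)) * norm (f x))"
  let ?v = "\<lambda>\<xi>. ennreal (exp (K * c * \<omega> (norm \<xi>)) * norm (fourier f \<xi>))"
  have "ennreal (exp (c * \<omega> (norm (x, \<xi>))) * norm (rihaczek f (x, \<xi>))) \<le> ennreal (exp (K * c)) * (?u x * ?v \<xi>)" for x \<xi>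
  proof -
    have "exp (c * \<omega> (norm (x, \<xi>))) * (norm (f x) * norm (fourier f \<xi>)) \<le>
      exp (K * c) * exp (K * c * \<omega> (norm x)) * exp (K * c * \<omega> (norm \<xi>)) * (norm (f x) * norm (fourier f \<xi>))"
      using \<open>0 \<le> c\<close> norm_Pair_bounds(3) by (intro mult_right_mono exp_weight_le) auto
    then show ?thesis
      by (simp add: norm_rihaczek ennreal_mult'[symmetric] mult_ac)
  qed
  then have "(\<integral>\<^sup>+z. ennreal (exp (c * \<omega> (norm z)) * norm (rihaczek f z)) \<partial>lborel)
     \<le> (\<integral>\<^sup>+x. \<integral>\<^sup>+\<xi>. ennreal (exp (K * c)) * (?u x * ?v \<xi>) \<partial>lborel \<partial>lborel)"
    by (subst nn_integral_lborel_pair(1)) (auto intro!: nn_integral_mono)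
  also have "\<dots> = ennreal (exp (K * c)) * ((\<integral>\<^sup>+x. ?u x \<partial>lborel) * (\<integral>\<^sup>+\<xi>. ?v \<xi> \<partial>lborel))"
    by (simp add: nn_integral_cmult nn_integral_multc)
  also have "\<dots> < \<infinity>"
    using rapid_weighted_integrable[OF S_omega_rapid(1)[OF f], of "K * c"]
      rapid_weighted_integrable[OF S_omega_rapid(2)[OF f], of "K * c"] K_ge_1 \<open>0 \<le> c\<close>
    by (simp add: ennreal_mult_less_top)
  finally show ?thesis .
qed

subsection \<open>Weighted pointwise bounds\<close>

lemma exp_weighted_measurable [measurable]:
  fixes F :: "'a::euclidean_space \<Rightarrow> 'b::{real_normed_vector, second_countable_topology}"
  assumes [measurable]: "F \<in> borel_measurable borel"
  shows "exp_weighted \<omega> c F \<in> borel_measurable borel"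
  unfolding exp_weighted_def by measurable

section \<open>The weighted spectrogram bounded by Rihaczek forms\<close>

lemma weighted_spectrogram_le:
  fixes f g :: "real^'n::finite \<Rightarrow> complex"
  assumes f: "f \<in> S_omega \<omega>" and g: "g \<in> S_omega \<omega>" and l: "0 \<le> l"
  shows "ennreal (exp (l * \<omega> (norm z)) * \<bar>spectrogram g f z\<bar>) \<le> D1 CARD('n) K l *
    (\<integral>\<^sup>+w. ennreal (norm (exp_weighted \<omega> (2 * K\<^sup>2 * l) (rihaczek f) w) *
        norm (exp_weighted \<omega> (2 * K\<^sup>2 * l) (rihaczek g) (w - z))) \<partial>lborel)"
    (is "_ \<le> _ * (\<integral>\<^sup>+w. ennreal (?u w * ?v (w - z)) \<partial>lborel)")
proof -
  note [measurable] = regularD(3)[OF S_omega_regular(1)[OF f]] regularD(3)[OF S_omega_regular(1)[OF g]]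
  let ?N = "CARD('n)" and ?e = "exp (K * (1 + 2 * K) * l)"
  \<comment> \<open>Quasi-subadditivity yields the exponents K l; since K \<ge> 1, they may be
    enlarged to those in the stated estimate.\<close>
  have K: "K * l \<le> K * (1 + 2 * K) * l" "K * l \<le> 2 * K\<^sup>2 * l"
    using mult_right_mono[of 1 "1 + 2 * K" "K * l"] mult_right_mono[of 1 "2 * K" "K * l"] K_ge_1 l
    by (simp_all add: power2_eq_square mult_ac)
  have w: "exp (l * \<omega> (norm z)) \<le> ?e * exp (2 * K\<^sup>2 * l * \<omega> (norm w)) * exp (2 * K\<^sup>2 * l * \<omega> (norm (w - z)))" for w
  proof -
    \<comment> \<open>z is the difference of w and w - z, so its norm is at most the sum of
      theirs.\<close>
    have "exp (l * \<omega> (norm z)) \<le> exp (K * l) * exp (K * l * \<omega> (norm w)) * exp (K * l * \<omega> (norm (w - z)))"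
      using norm_triangle_ineq4[of w "w - z"] by (intro exp_weight_le l) auto
    also have "\<dots> \<le> ?e * exp (2 * K\<^sup>2 * l * \<omega> (norm w)) * exp (2 * K\<^sup>2 * l * \<omega> (norm (w - z)))"
      using K weight_nonneg by (intro mult_mono) (auto intro!: mult_right_mono)
    finally show ?thesis .
  qed
  have "ennreal ((2 * pi) ^ ?N) * ennreal (exp (l * \<omega> (norm z)) * \<bar>spectrogram g f z\<bar>) =
    ennreal (exp (l * \<omega> (norm z))) * ennreal ((2 * pi) ^ ?N * spectrogram g f z)"
    by (simp add: ennreal_mult'[symmetric] spectrogram_def mult_ac)
  also have "\<dots> \<le> ennreal (exp (l * \<omega> (norm z))) * (\<integral>\<^sup>+w. ennreal (norm (rihaczek f w) * norm (rihaczek g (w - z))) \<partial>lborel)"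
    by (intro mult_left_mono spectrogram_le S_omega_regular f g) simp
  also have "\<dots> = (\<integral>\<^sup>+w. ennreal (exp (l * \<omega> (norm z)) * (norm (rihaczek f w) * norm (rihaczek g (w - z)))) \<partial>lborel)"
    by (simp add: nn_integral_cmult ennreal_mult')
  also have "\<dots> \<le> (\<integral>\<^sup>+w. ennreal ?e * ennreal (?u w * ?v (w - z)) \<partial>lborel)"
  proof (intro nn_integral_mono)
    fix w
    have "exp (l * \<omega> (norm z)) * (norm (rihaczek f w) * norm (rihaczek g (w - z))) \<le>
      ?e * exp (2 * K\<^sup>2 * l * \<omega> (norm w)) * exp (2 * K\<^sup>2 * l * \<omega> (norm (w - z))) * (norm (rihaczek f w) * norm (rihaczek g (w - z)))"
      by (intro mult_right_mono w) simp
    also have "\<dots> = ?e * (?u w * ?v (w - z))"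
      by (simp add: norm_exp_weighted mult_ac)
    finally show "ennreal (exp (l * \<omega> (norm z)) * (norm (rihaczek f w) * norm (rihaczek g (w - z)))) \<le> ennreal ?e * ennreal (?u w * ?v (w - z))"
      by (simp add: ennreal_mult'[symmetric])
  qed
  also have "\<dots> = ennreal ?e * (\<integral>\<^sup>+w. ennreal (?u w * ?v (w - z)) \<partial>lborel)"
    unfolding norm_exp_weighted by (rule nn_integral_cmult) measurable
  also have "\<dots> = ennreal ((2 * pi) ^ ?N) * (D1 ?N K l * (\<integral>\<^sup>+w. ennreal (?u w * ?v (w - z)) \<partial>lborel))"
    by (simp add: D1_def ennreal_mult'[symmetric] mult.assoc[symmetric])
  finally show ?thesis
    by (subst (asm) ennreal_mult_le_mult_iff) (auto simp: ennreal_eq_0_iff not_le)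
qed

lemma weighted_spectrogram_le_Lp:
  fixes f g :: "real^'n::finite \<Rightarrow> complex"
  assumes f: "f \<in> S_omega \<omega>" and g: "g \<in> S_omega \<omega>" and l: "0 \<le> l" and p: "1 \<le> p"
  shows "ennreal (exp (l * \<omega> (norm z)) * \<bar>spectrogram g f z\<bar>) \<le> D1 CARD('n) K l
    * Lp_norm p (exp_weighted \<omega> (2 * K\<^sup>2 * l) (rihaczek f))
    * Lp_norm (conj_exponent p) (exp_weighted \<omega> (2 * K\<^sup>2 * l) (rihaczek g))"
proof -
  note [measurable] = regularD(3)[OF S_omega_regular(1)[OF f]] regularD(3)[OF S_omega_regular(1)[OF g]]
  let ?u = "\<lambda>w. norm (exp_weighted \<omega> (2 * K\<^sup>2 * l) (rihaczek f) w)"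
  let ?v = "\<lambda>w. norm (exp_weighted \<omega> (2 * K\<^sup>2 * l) (rihaczek g) w)"
  have "(\<integral>\<^sup>+w. ennreal (?u w * ?v (w - z)) \<partial>lborel) \<le> Lp_norm p ?u * Lp_norm (conj_exponent p) (\<lambda>w. ?v (w - z))"
    unfolding nn_integral_lebesgue_lborel[symmetric]
    by (intro Lp_norm_Hoelder p borel_imp_lebesgue_measurable) simp_all
  also have "\<dots> \<le> Lp_norm p ?u * Lp_norm (conj_exponent p) ?v"
    by (intro mult_left_mono Lp_norm_translate_le) simp_all
  finally have "(\<integral>\<^sup>+w. ennreal (?u w * ?v (w - z)) \<partial>lborel) \<le>
      Lp_norm p (exp_weighted \<omega> (2 * K\<^sup>2 * l) (rihaczek f)) *
      Lp_norm (conj_exponent p) (exp_weighted \<omega> (2 * K\<^sup>2 * l) (rihaczek g))"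
    by (simp only: Lp_norm_norm)
  then show ?thesis
    using weighted_spectrogram_le[OF f g l, of z] unfolding mult.assoc
    by (meson mult_left_mono order_trans zero_le)
qed

text \<open>The pointwise bound is of convolution type, so integrating it over z and exchanging the
  integrals gives a product of two finite weighted integrals.\<close>

lemma weighted_spectrogram_integrable:
  fixes f g :: "real^'n::finite \<Rightarrow> complex"
  assumes f: "f \<in> S_omega \<omega>" and g: "g \<in> S_omega \<omega>" and l: "0 \<le> l"
  shows "(\<integral>\<^sup>+z. ennreal (exp (l * \<omega> (norm z)) * \<bar>spectrogram g f z\<bar>) \<partial>lborel) < \<infinity>"
proof -
  note [measurable] = regularD(3)[OF S_omega_regular(1)[OF f]] regularD(3)[OF S_omega_regular(1)[OF g]]
  let ?u = "\<lambda>w. ennreal (norm (exp_weighted \<omega> (2 * K\<^sup>2 * l) (rihaczek f) w))"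
  let ?v = "\<lambda>w. ennreal (norm (exp_weighted \<omega> (2 * K\<^sup>2 * l) (rihaczek g) w))"
  have "(\<integral>\<^sup>+z. ennreal (exp (l * \<omega> (norm z)) * \<bar>spectrogram g f z\<bar>) \<partial>lborel)
     \<le> (\<integral>\<^sup>+z. D1 CARD('n) K l * (\<integral>\<^sup>+w. ?u w * ?v (w - z) \<partial>lborel) \<partial>lborel)"
    by (intro nn_integral_mono) (use weighted_spectrogram_le[OF f g l] in \<open>simp add: ennreal_mult'\<close>)
  also have "\<dots> = D1 CARD('n) K l * (\<integral>\<^sup>+z. \<integral>\<^sup>+w. ?u w * ?v (w - z) \<partial>lborel \<partial>lborel)"
    by (rule nn_integral_cmult) measurable
  also have "(\<integral>\<^sup>+z. \<integral>\<^sup>+w. ?u w * ?v (w - z) \<partial>lborel \<partial>lborel) = (\<integral>\<^sup>+w. \<integral>\<^sup>+z. ?u w * ?v (w - z) \<partial>lborel \<partial>lborel)"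
    by (rule lborel_pair.Fubini') measurable
  also have "\<dots> = (\<integral>\<^sup>+w. ?u w * (\<integral>\<^sup>+z. ?v z \<partial>lborel) \<partial>lborel)"
    by (simp add: nn_integral_cmult nn_integral_lborel_reflect[where f="?v"])
  also have "\<dots> = (\<integral>\<^sup>+w. ?u w \<partial>lborel) * (\<integral>\<^sup>+z. ?v z \<partial>lborel)"
    by (rule nn_integral_multc) measurable
  also have "D1 CARD('n) K l * \<dots> < \<infinity>"
    using rihaczek_weighted_integrable[OF f, of "2 * K\<^sup>2 * l"] rihaczek_weighted_integrable[OF g, of "2 * K\<^sup>2 * l"] l
    by (simp add: ennreal_mult_less_top norm_exp_weighted D1_def)
  finally show ?thesis .
qed

section \<open>The weighted Rihaczek form bounded by the spectrogram\<close>

text \<open>Used with \<open>(F, G, P) = (f, g, fst)\<close> and with the Fourier transforms and \<open>snd\<close>.\<close>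

lemma weighted_norm_le_stft:
  fixes f g F G :: "real^'n::finite \<Rightarrow> complex" and P :: "(real^'n) \<times> (real^'n) \<Rightarrow> real^'n"
  assumes f: "f \<in> S_omega \<omega>" and g: "g \<in> S_omega \<omega>" and l: "0 \<le> l"
    and cont: "continuous_on UNIV G" and [measurable]: "P \<in> borel_measurable borel" and P: "\<And>z. norm (P z) \<le> norm z"
    and le: "ennreal ((2 * pi) ^ CARD('n) * norm (F x)) * I
       \<le> (\<integral>\<^sup>+z. ennreal (norm (stft g f z) * norm (G (x - P z))) \<partial>lborel)"
  shows "ennreal (exp (K * l * \<omega> (norm x)) * ((2 * pi) ^ CARD('n) * norm (F x))) * I
    \<le> ennreal (exp (K\<^sup>2 * l)) * Lp_norm \<infinity> (exp_weighted \<omega> (K\<^sup>2 * l) G) *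
       (\<integral>\<^sup>+z. ennreal (exp (K\<^sup>2 * l * \<omega> (norm z)) * norm (stft g f z)) \<partial>lborel)"
proof -
  note [measurable] = regularD(3)[OF S_omega_regular(1)[OF f]] regularD(3)[OF S_omega_regular(1)[OF g]]
    borel_measurable_continuous_onI[OF cont]
  let ?A = "Lp_norm \<infinity> (exp_weighted \<omega> (K\<^sup>2 * l) G)" and ?c = "exp (K * l * \<omega> (norm x))"
  have "ennreal (?c * ((2 * pi) ^ CARD('n) * norm (F x))) * I = ennreal ?c * (ennreal ((2 * pi) ^ CARD('n) * norm (F x)) * I)"
    by (simp add: ennreal_mult' mult_ac)
  also have "\<dots> \<le> ennreal ?c * (\<integral>\<^sup>+z. ennreal (norm (stft g f z) * norm (G (x - P z))) \<partial>lborel)"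
    by (intro mult_left_mono le) simp
  also have "\<dots> = (\<integral>\<^sup>+z. ennreal ?c * ennreal (norm (stft g f z) * norm (G (x - P z))) \<partial>lborel)"
    by (rule nn_integral_cmult[symmetric]) measurable
  also have "\<dots> \<le> (\<integral>\<^sup>+z. (ennreal (exp (K\<^sup>2 * l)) * ?A) * ennreal (exp (K\<^sup>2 * l * \<omega> (norm z)) * norm (stft g f z)) \<partial>lborel)"
  proof (intro nn_integral_mono)
    fix z
    \<comment> \<open>Splitting x into P z and x - P z at exponent K l multiplies it by a further K,
      whence K^2 l.\<close>
    have "?c \<le> exp (K\<^sup>2 * l) * exp (K\<^sup>2 * l * \<omega> (norm (P z))) * exp (K\<^sup>2 * l * \<omega> (norm (x - P z)))"
      using exp_weight_le[of "K * l" "norm x" "norm (P z)" "norm (x - P z)"] K_ge_1 l norm_triangle_sub[of x "P z"]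
      by (simp add: power2_eq_square mult_ac)
    \<comment> \<open>Because P does not increase norms, the weight at P z is replaced by the one at
      z.\<close>
    also have "\<dots> \<le> exp (K\<^sup>2 * l) * exp (K\<^sup>2 * l * \<omega> (norm z)) * exp (K\<^sup>2 * l * \<omega> (norm (x - P z)))"
      using l P[of z] by (intro mult_left_mono mult_right_mono) (simp_all add: mult_left_mono weight_mono)
    finally have "?c * (norm (stft g f z) * norm (G (x - P z))) \<le>
       exp (K\<^sup>2 * l) * exp (K\<^sup>2 * l * \<omega> (norm z)) * exp (K\<^sup>2 * l * \<omega> (norm (x - P z))) * (norm (stft g f z) * norm (G (x - P z)))"
      by (rule mult_right_mono) simp
    then have "ennreal (?c * (norm (stft g f z) * norm (G (x - P z)))) \<le>
       ennreal (exp (K\<^sup>2 * l)) * ennreal (norm (exp_weighted \<omega> (K\<^sup>2 * l) G (x - P z))) *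
         ennreal (exp (K\<^sup>2 * l * \<omega> (norm z)) * norm (stft g f z))"
      by (simp add: norm_exp_weighted ennreal_mult'[symmetric] mult_ac)
    also have "\<dots> \<le> ennreal (exp (K\<^sup>2 * l)) * ?A * ennreal (exp (K\<^sup>2 * l * \<omega> (norm z)) * norm (stft g f z))"
      by (intro mult_right_mono mult_left_mono continuous_le_Lp_norm_top exp_weighted_continuous cont) simp_all
    finally show "ennreal ?c * ennreal (norm (stft g f z) * norm (G (x - P z))) \<le>
        ennreal (exp (K\<^sup>2 * l)) * ?A * ennreal (exp (K\<^sup>2 * l * \<omega> (norm z)) * norm (stft g f z))"
      by (simp add: ennreal_mult')
  qed
  also have "\<dots> = ennreal (exp (K\<^sup>2 * l)) * ?A * (\<integral>\<^sup>+z. ennreal (exp (K\<^sup>2 * l * \<omega> (norm z)) * norm (stft g f z)) \<partial>lborel)"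
    by (rule nn_integral_cmult) measurable
  finally show ?thesis .
qed

text \<open>Inserting exp (\<mu> \<omega>) exp (- \<mu> \<omega>) allows Hoelder's inequality with
  exponent 2p and its conjugate; squaring turns |V_g f| into the spectrogram.\<close>

lemma weighted_stft_le_Lp:
  fixes f g :: "real^'n::finite \<Rightarrow> complex"
  assumes f: "f \<in> S_omega \<omega>" and g: "g \<in> S_omega \<omega>" and p: "1 \<le> p"
  shows "(\<integral>\<^sup>+z. ennreal (exp (c * \<omega> (norm z)) * norm (stft g f z)) \<partial>lborel)\<^sup>2 \<le>
    Lp_norm p (exp_weighted \<omega> (2 * (c + \<mu>)) (spectrogram g f)) *
    (Lp_norm (conj_exponent (2 * p)) (\<lambda>z :: (real^'n) \<times> (real^'n). exp (- \<mu> * \<omega> (norm z))))\<^sup>2"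
proof -
  note [measurable] = regularD(3)[OF S_omega_regular(1)[OF f]] regularD(3)[OF S_omega_regular(1)[OF g]]
  let ?u = "\<lambda>z. exp ((c + \<mu>) * \<omega> (norm z)) * norm (stft g f z)"
  let ?v = "\<lambda>z :: (real^'n) \<times> (real^'n). exp (- \<mu> * \<omega> (norm z))"
  have m: "?u \<in> borel_measurable lebesgue" "?v \<in> borel_measurable lebesgue"
    by (rule borel_imp_lebesgue_measurable, measurable)+
  have "1 \<le> 2 * p"
    using p order_trans[OF p, of "2 * p"] mult_right_mono[of 1 2 p] by simp
  have eq: "exp (c * \<omega> (norm z)) * norm (stft g f z) = ?u z * ?v z" for z
  proof -
    have "exp (c * \<omega> (norm z)) = exp ((c + \<mu>) * \<omega> (norm z)) * ?v z"
      by (simp add: exp_add[symmetric] algebra_simps)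
    then show ?thesis by simp
  qed
  have "(\<integral>\<^sup>+z. ennreal (exp (c * \<omega> (norm z)) * norm (stft g f z)) \<partial>lborel) = (\<integral>\<^sup>+z. ennreal (?u z * ?v z) \<partial>lebesgue)"
    by (simp only: nn_integral_lebesgue_lborel eq)
  also have "\<dots> \<le> Lp_norm (2 * p) ?u * Lp_norm (conj_exponent (2 * p)) ?v"
    by (intro Lp_norm_Hoelder m \<open>1 \<le> 2 * p\<close>) simp_all
  finally have "(\<integral>\<^sup>+z. ennreal (exp (c * \<omega> (norm z)) * norm (stft g f z)) \<partial>lborel)\<^sup>2 \<le>
      (Lp_norm (2 * p) ?u * Lp_norm (conj_exponent (2 * p)) ?v)\<^sup>2"
    by (rule power_mono) simp
  also have "\<dots> = (Lp_norm (2 * p) ?u)\<^sup>2 * (Lp_norm (conj_exponent (2 * p)) ?v)\<^sup>2"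
    by (rule power_mult_distrib)
  also have "\<dots> \<le> Lp_norm p (\<lambda>z. (?u z)\<^sup>2) * (Lp_norm (conj_exponent (2 * p)) ?v)\<^sup>2"
    by (intro mult_right_mono Lp_norm_double_square p m) simp_all
  also have "(\<lambda>z. (?u z)\<^sup>2) = exp_weighted \<omega> (2 * (c + \<mu>)) (spectrogram g f)"
    by (simp add: fun_eq_iff exp_weighted_def spectrogram_def power_mult_distrib exp_double[symmetric] mult_ac)
  finally show ?thesis .
qed

text \<open>|Rf| is the product of |f| and |f^|. Each factor is bounded by a sup norm of the window
  times the same weighted integral of |V_g f|, whose square is controlled by
  \<open>weighted_stft_le_Lp\<close>.\<close>

lemma weighted_rihaczek_le_Lp:
  fixes f g :: "real^'n::finite \<Rightarrow> complex"
  assumes f: "f \<in> S_omega \<omega>" and g: "g \<in> S_omega \<omega>" "g \<noteq> (\<lambda>_. 0)" and l: "0 \<le> l" and p: "1 \<le> p"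
  shows "ennreal (exp (l * \<omega> (norm z)) * norm (rihaczek f z)) \<le> D2 \<omega> K (conj_exponent (2 * p)) g l \<mu>
    * Lp_norm p (exp_weighted \<omega> (2 * (K\<^sup>2 * l + \<mu>)) (spectrogram g f))"
proof -
  obtain x \<xi> where z: "z = (x, \<xi>)" by fastforce
  note rf = S_omega_regular[OF f] and rg = S_omega_regular[OF g(1)]
  let ?c = "(2 * pi) ^ CARD('n)"
  let ?A = "Lp_norm \<infinity> (exp_weighted \<omega> (K\<^sup>2 * l) g)" and ?B = "Lp_norm \<infinity> (exp_weighted \<omega> (K\<^sup>2 * l) (fourier g))"
  let ?T = "\<integral>\<^sup>+z. ennreal (exp (K\<^sup>2 * l * \<omega> (norm z)) * norm (stft g f z)) \<partial>lborel"
  let ?Q = "Lp_norm (conj_exponent (2 * p)) (\<lambda>z :: (real^'n) \<times> (real^'n). exp (- \<mu> * \<omega> (norm z)))"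
  let ?P = "Lp_norm p (exp_weighted \<omega> (2 * (K\<^sup>2 * l + \<mu>)) (spectrogram g f))"
  define G where "G = (\<integral>\<^sup>+y. ennreal ((norm (g y))\<^sup>2) \<partial>lborel)"
  have G: "G \<noteq> 0" "G < \<infinity>"
    using regular_nonzero[OF rg(1) g(2)] by (auto simp: G_def)
  \<comment> \<open>The denominator of \<open>D2\<close>. It is finite and nonzero, so the estimate
    is proved after multiplication by d and divided at the end.\<close>
  define d where "d = ennreal ((2 * pi) ^ (2 * CARD('n))) * (Lp_norm 2 g) ^ 4"
  have "ennreal ((2 * pi) ^ (2 * CARD('n))) = ennreal ?c * ennreal ?c"
    unfolding mult_2[of "CARD('n)"] power_add by (rule ennreal_mult') simp
  moreover have "(Lp_norm 2 g) ^ 4 = G\<^sup>2"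
    unfolding G_def by (rule Lp_norm_two_power4) (use G(2) in \<open>simp only: G_def\<close>)
  ultimately have d: "d = ennreal ?c * ennreal ?c * (G * G)"
    by (simp only: d_def power2_eq_square)
  have d0: "d \<noteq> 0" "d \<noteq> \<infinity>"
    using G unfolding d by (auto simp: ennreal_mult_eq_top_iff)
  \<comment> \<open>X and Y each carry one factor (2 pi)^N and one energy of g; their product
    absorbs d.\<close>
  define X where "X = ennreal (exp (K * l * \<omega> (norm x)) * (?c * norm (f x))) * G"
  define Y where "Y = ennreal (exp (K * l * \<omega> (norm \<xi>)) * (?c * norm (fourier f \<xi>))) * G"
  have X: "X \<le> ennreal (exp (K\<^sup>2 * l)) * ?A * ?T"
    unfolding X_def
    by (rule weighted_norm_le_stft[OF f g(1) l regularD(2)[OF rg(1)] measurable_fst_borel])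
       (use norm_le_stft[OF rf(1) rg(1)] norm_fst_le in \<open>auto simp: G_def\<close>)
  have Y: "Y \<le> ennreal (exp (K\<^sup>2 * l)) * ?B * ?T"
    unfolding Y_def
    by (rule weighted_norm_le_stft[OF f g(1) l regularD(2)[OF rg(2)] measurable_snd_borel])
       (use norm_fourier_le_stft[OF rf rg] norm_snd_le in \<open>auto simp: G_def\<close>)
  have "ennreal (exp (l * \<omega> (norm z)) * norm (rihaczek f z)) * d \<le>
    ennreal (exp (K * l) * exp (K * l * \<omega> (norm x)) * exp (K * l * \<omega> (norm \<xi>)) * norm (rihaczek f z)) * d"
    unfolding z using norm_Pair_bounds(3) l
    by (intro mult_right_mono ennreal_leI exp_weight_le) auto
  also have "\<dots> = ennreal (exp (K * l)) * (X * Y)"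
    unfolding d X_def Y_def norm_rihaczek z by (simp add: ennreal_mult' mult_ac)
  also have "\<dots> \<le> ennreal (exp (K * l)) * ((ennreal (exp (K\<^sup>2 * l)) * ?A * ?T) * (ennreal (exp (K\<^sup>2 * l)) * ?B * ?T))"
    by (intro mult_left_mono mult_mono X Y) simp_all
  also have "\<dots> = ennreal (exp (K * l) * (exp (K\<^sup>2 * l) * exp (K\<^sup>2 * l))) * ?A * ?B * ?T\<^sup>2"
    by (simp add: ennreal_mult' power2_eq_square mult_ac)
  \<comment> \<open>Separating x from \<xi> costs K l in the exponent, and each of the bounds for X
    and Y costs K^2 l.\<close>
  also have "exp (K * l) * (exp (K\<^sup>2 * l) * exp (K\<^sup>2 * l)) = exp (K * (1 + 2 * K) * l)"
    by (simp add: exp_add[symmetric] power2_eq_square algebra_simps)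
  also have "ennreal (exp (K * (1 + 2 * K) * l)) * ?A * ?B * ?T\<^sup>2 \<le> ennreal (exp (K * (1 + 2 * K) * l)) * ?A * ?B * (?P * ?Q\<^sup>2)"
    by (intro mult_left_mono weighted_stft_le_Lp f g p) simp
  finally have "ennreal (exp (l * \<omega> (norm z)) * norm (rihaczek f z)) * d / d \<le>
      ennreal (exp (K * (1 + 2 * K) * l)) * ?A * ?B * (?P * ?Q\<^sup>2) / d"
    by (rule divide_right_mono_ennreal)
  moreover have "ennreal (exp (l * \<omega> (norm z)) * norm (rihaczek f z)) * d / d = ennreal (exp (l * \<omega> (norm z)) * norm (rihaczek f z))"
    using d0 by (intro mult_divide_eq_ennreal) simp_all
  ultimately show ?thesis
    unfolding D2_def d_def[symmetric] by (simp only: divide_ennreal_def mult_ac)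
qed

end

section \<open>Lower bound for the measure of E\<close>

theorem proposition3p3:
  fixes \<omega> :: "real \<Rightarrow> real" and K b \<epsilon> :: real
    and E :: "((real^'n::finite) \<times> (real^'n)) set" and p :: ennreal
  assumes "weight_function \<omega> K b"
    and "E \<in> sets lebesgue"
    and "1 \<le> p"
    and "0 < \<epsilon>" and "\<epsilon> < 1"
    and "(\<exists>(f :: real^'n \<Rightarrow> complex) (g :: real^'n \<Rightarrow> complex) (l::real).
            f \<in> S_omega \<omega> \<and> g \<in> S_omega \<omega> \<and> f \<noteq> (\<lambda>_. 0) \<and> g \<noteq> (\<lambda>_. 0) \<and> l \<ge> 0 \<and>
            (\<integral>\<^sup>+z\<in>E. ennreal (exp (l * \<omega> (norm z)) * \<bar>spectrogram g f z\<bar>) \<partial>lebesgue)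
              \<ge> ennreal (1 - \<epsilon>) * D1 CARD('n) K l
                  * Lp_norm p (exp_weighted \<omega> (2 * K\<^sup>2 * l) (rihaczek f))
                  * Lp_norm (conj_exponent p) (exp_weighted \<omega> (2 * K\<^sup>2 * l) (rihaczek g)))
       \<or> (\<exists>(f :: real^'n \<Rightarrow> complex) (g :: real^'n \<Rightarrow> complex) (l::real) (\<mu>::real).
            f \<in> S_omega \<omega> \<and> g \<in> S_omega \<omega> \<and> f \<noteq> (\<lambda>_. 0) \<and> g \<noteq> (\<lambda>_. 0) \<and> l \<ge> 0 \<and>
            \<mu> > 2 * real CARD('n) / (b * enn2real (conj_exponent (2 * p))) \<and>
            (\<integral>\<^sup>+z\<in>E. ennreal (exp (l * \<omega> (norm z)) * norm (rihaczek f z)) \<partial>lebesgue)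
              \<ge> ennreal (1 - \<epsilon>) * D2 \<omega> K (conj_exponent (2 * p)) g l \<mu>
                  * Lp_norm p (exp_weighted \<omega> (2 * (K\<^sup>2 * l + \<mu>)) (spectrogram g f)))"
  shows "emeasure lebesgue E \<ge> ennreal (1 - \<epsilon>)"
proof -
  interpret weight \<omega> K b
    by unfold_locales fact
  \<comment> \<open>Finiteness over the whole phase space yields finiteness over E.\<close>
  have set_le: "(\<integral>\<^sup>+z\<in>E. F z \<partial>lebesgue) \<le> (\<integral>\<^sup>+z. F z \<partial>lborel)" for F :: "(real^'n) \<times> (real^'n) \<Rightarrow> ennreal"
    unfolding nn_integral_lebesgue_lborel by (intro nn_integral_mono) (simp add: indicator_def)
  from assms(6) show ?thesis
  proof (elim disjE exE conjE)
    fix f g :: "real^'n \<Rightarrow> complex" and l :: real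
    assume f: "f \<in> S_omega \<omega>" "f \<noteq> (\<lambda>_. 0)" and g: "g \<in> S_omega \<omega>" "g \<noteq> (\<lambda>_. 0)" and l: "l \<ge> 0"
      and ge: "(\<integral>\<^sup>+z\<in>E. ennreal (exp (l * \<omega> (norm z)) * \<bar>spectrogram g f z\<bar>) \<partial>lebesgue)
              \<ge> ennreal (1 - \<epsilon>) * D1 CARD('n) K l
                  * Lp_norm p (exp_weighted \<omega> (2 * K\<^sup>2 * l) (rihaczek f))
                  * Lp_norm (conj_exponent p) (exp_weighted \<omega> (2 * K\<^sup>2 * l) (rihaczek g))"
    obtain z0 where "stft g f z0 \<noteq> 0"
      using stft_nonzero S_omega_regular(1) f g by blast
    then have "ennreal (exp (l * \<omega> (norm z0)) * \<bar>spectrogram g f z0\<bar>) \<noteq> 0"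
      by (simp add: spectrogram_def ennreal_eq_0_iff not_le)
    then show ?thesis
      using ge \<open>\<epsilon> < 1\<close>
      by (intro measure_ge_of_concentration[OF \<open>E \<in> sets lebesgue\<close> weighted_spectrogram_le_Lp[OF f(1) g(1) l \<open>1 \<le> p\<close>] _
            order_le_less_trans[OF set_le weighted_spectrogram_integrable[OF f(1) g(1) l]]])
         (simp_all add: mult.assoc)
  next
    fix f g :: "real^'n \<Rightarrow> complex" and l \<mu> :: real
    assume f: "f \<in> S_omega \<omega>" "f \<noteq> (\<lambda>_. 0)" and g: "g \<in> S_omega \<omega>" "g \<noteq> (\<lambda>_. 0)" and l: "l \<ge> 0"
      and ge: "(\<integral>\<^sup>+z\<in>E. ennreal (exp (l * \<omega> (norm z)) * norm (rihaczek f z)) \<partial>lebesgue)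
              \<ge> ennreal (1 - \<epsilon>) * D2 \<omega> K (conj_exponent (2 * p)) g l \<mu>
                  * Lp_norm p (exp_weighted \<omega> (2 * (K\<^sup>2 * l + \<mu>)) (spectrogram g f))"
    \<comment> \<open>Since |Rf| factorises, points where f and its transform are nonzero can be
      chosen independently and paired.\<close>
    obtain x where "f x \<noteq> 0"
      using f(2) by auto
    moreover obtain \<xi> where "fourier f \<xi> \<noteq> 0"
      using fourier_nonzero[OF S_omega_regular(1)[OF f(1)] f(2)] .
    ultimately have "ennreal (exp (l * \<omega> (norm (x, \<xi>))) * norm (rihaczek f (x, \<xi>))) \<noteq> 0"
      by (simp add: norm_rihaczek ennreal_eq_0_iff not_le)
    then show ?thesis
      using ge \<open>\<epsilon> < 1\<close>
      by (intro measure_ge_of_concentration[OF \<open>E \<in> sets lebesgue\<close> weighted_rihaczek_le_Lp[OF f(1) g l \<open>1 \<le> p\<close>, of _ \<mu>] _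
            order_le_less_trans[OF set_le rihaczek_weighted_integrable[OF f(1) l]]])
         (simp_all add: mult.assoc)
  qed
qed

end
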